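(* Let $B>0$, let $(F,X)\in K_{kc}^B(\mathbb{R}^d)\times\mathcal{X}$ be a pair of random elements with $\mathcal{X}\subset\mathbb{R}^p$ compact, and let $T\in\{0,1\}$ be a random variable such that $F$ and $T$ are independent given $X$. Let $\{F_i,X_i,T_i\}_{i=1}^n$ be an i.i.d. sample from the distribution of $(F,X,T)$, let $e(x)=\mathbb{P}(T=1|X=x)$, and let $\hat e(x)$ be a nonnegative estimator of $e(x)$. Let $$\hat{\mathbb{E}}_\oplus[F]=\mathrm{argmin}_{\nu\in K_{kc}^B(\mathbb{R}^d)}\frac1n\sum_{i=1}^n\frac{T_i}{\hat e(X_i)}d_{kc}^2(\nu,F_i)=\left(\frac1n\sum_{i=1}^n\frac{T_i}{\hat e(X_i)}\right)^{-1}\frac1n\bigoplus_{i=1}^n\frac{T_i}{\hat e(X_i)}F_i.$$ Suppose that the following conditions hold. (i) There exists a constant $\eta_0\in(0,1/2)$ such that $\eta_0\le e(x)\le 1-\eta_0$ for all $x\in\mathcal{X}$. (ii) $\sup_{x\in\mathcal{X}}|\hat e(x)-e(x)|=O_p(\rho_n)$ with $\rho_n\to0$ as $n\to\infty$. (iii) As $\delta\to0$, $\int_0^1\sqrt{\log N(\delta\varepsilon,B_{\delta'}(e),\|\cdot\|_\infty)}\,d\varepsilon=O(\delta^{-\varpi_1})$ for some $\delta'>0$ and $\varpi_1\in(0,1)$, where $\|e_1-e_2\|_\infty=\sup_{x\in\mathcal{X}}|e_1(x)-e_2(x)|$ for $e_1,e_2:\mathcal{X}\to\mathbb{R}$, and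 $B_\gamma(e)$ is the ball of radius $\gamma>0$ centered at $e$. Then, for $d\le4$, $$d_{kc}(\hat{\mathbb{E}}_\oplus[F],\mathbb{E}_\oplus[F])=O_p\left(n^{-\frac{1}{2(1+\max\{(d-1)/4,\varpi_1\})}}+\rho_n^{\varpi_2}\right)\quad\text{for any }\varpi_2\in(0,1).$$
   Context: $K_{kc}(\mathbb{R}^d)$ is the collection of nonempty compact convex subsets of $\mathbb{R}^d$, and $K_{kc}^B(\mathbb{R}^d)=\{F\in K_{kc}(\mathbb{R}^d):\sup_{f\in F}\|f\|\le B\}$. For $t\in\mathbb{R}$, $tF=\{tf:f\in F\}$; $F\oplus G=\{f+g:f\in F,g\in G\}$ is the Minkowski sum and $\bigoplus_{i=1}^n F_i$ is the Minkowski sum of $F_1,\dots,F_n$. Support function: $s(p,F)=\sup_{f\in F}\langle p,f\rangle$ for $p\in\mathbb{S}^{d-1}=\{x\in\mathbb{R}^d:\|x\|=1\}$. The metric is $d_{kc}(F,G)=(\int_{\mathbb{S}^{d-1}}\{s(p,F)-s(p,G)\}^2dp)^{1/2}$, where $dp$ is the surface measure (counting measure on $\{-1,1\}$ when $d=1$). Fréchet mean: $\mathbb{E}_\oplus[F]=\mathrm{argmin}_{\nu\in K_{kc}^B(\mathbb{R}^d)}\mathbb{E}[d_{kc}^2(\nu,F)]$. $N(\varepsilon,\mathcal{F},d)$ is the covering number: the minimal number of balls of radius $\varepsilon$ (with respect to the metric $d$) needed to cover the set $\mathcal{F}$. The variable $T$ is the observation indicator in a missing-at-random setup in which one observes $TF$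 and $X$. *)

theory Defs
  imports "HOL-Probability.Probability" "HOL-Library.Set_Algebras"
begin

(* Surface measure via polar coordinates:
     sigma(A) = DIM * lborel {r x | 0 < r <= 1, x in A},
   written as a push-forward under x |-> x / |x|.  In dimension 1 it is counting measure on {-1, 1}. *)
definition sphere_measure :: "'a::euclidean_space measure" where
  "sphere_measure =
     scale_measure (of_nat DIM('a))
       (distr (restrict_space lborel (cball 0 1 - {0})) (restrict_space borel (sphere 0 1)) sgn)"

definition support_fun :: "'a::euclidean_space \<Rightarrow> 'a set \<Rightarrow> real" where
  "support_fun p F = (SUP f\<in>F. p \<bullet> f)"

definition d_kc :: "'a::euclidean_space set \<Rightarrow> 'a set \<Rightarrow> real" where
  "d_kc F G = sqrt (\<integral>p. (support_fun p F - support_fun p G)\<^sup>2 \<partial>sphere_measure)"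

definition Kkc :: "'a::euclidean_space set set" where
  "Kkc = {F. F \<noteq> {} \<and> compact F \<and> convex F}"

definition Kkc_bdd :: "real \<Rightarrow> 'a::euclidean_space set set" where
  "Kkc_bdd B = {F \<in> Kkc. (SUP f\<in>F. norm f) \<le> B}"

(* The Borel sigma-algebra of the metric space (Kkc_bdd B, d_kc). *)
definition Kkc_borel :: "real \<Rightarrow> 'a::euclidean_space set measure" where
  "Kkc_borel B = sigma (Kkc_bdd B) {U. openin (Metric_space.mtopology (Kkc_bdd B) d_kc) U}"

definition obs_space ::
  "real \<Rightarrow> 'x::euclidean_space set \<Rightarrow> ('a::euclidean_space set \<times> 'x \<times> real) measure" where
  "obs_space B S = Kkc_borel B \<Otimes>\<^sub>M (restrict_space borel S \<Otimes>\<^sub>M count_space {0, 1})"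

definition sigma_gen_by :: "'w measure \<Rightarrow> ('w \<Rightarrow> 'x::topological_space) \<Rightarrow> 'w measure" where
  "sigma_gen_by M X = vimage_algebra (space M) X borel"

definition cond_indep_given ::
  "'w measure \<Rightarrow> 'w measure \<Rightarrow> 'y measure \<Rightarrow> ('w \<Rightarrow> 'y) \<Rightarrow> 'z measure \<Rightarrow> ('w \<Rightarrow> 'z) \<Rightarrow> bool" where
  "cond_indep_given M G NY Y NZ Z \<longleftrightarrow>
     (\<forall>A\<in>sets NY. \<forall>C\<in>sets NZ. AE \<omega> in M.
        real_cond_exp M G (\<lambda>w. indicator A (Y w) * indicator C (Z w)) \<omega> =
        real_cond_exp M G (\<lambda>w. indicator A (Y w)) \<omega> * real_cond_exp M G (\<lambda>w. indicator C (Z w)) \<omega>)"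

(* e is a version of x |-> P(T = 1 | X = x). *)
definition is_propensity ::
  "'w measure \<Rightarrow> 'x::euclidean_space set \<Rightarrow> ('w \<Rightarrow> 'x) \<Rightarrow> ('w \<Rightarrow> real) \<Rightarrow> ('x \<Rightarrow> real) \<Rightarrow> bool" where
  "is_propensity M S X T e \<longleftrightarrow>
     e \<in> borel_measurable (restrict_space borel S) \<and>
     (AE \<omega> in M. real_cond_exp M (sigma_gen_by M X) (\<lambda>w. indicator {1} (T w)) \<omega> = e (X \<omega>))"

definition frechet_mean ::
  "'w measure \<Rightarrow> real \<Rightarrow> ('w \<Rightarrow> 'a::euclidean_space set) \<Rightarrow> 'a set" where
  "frechet_mean M B F = arg_min_on (\<lambda>\<nu>. \<integral>\<omega>. (d_kc \<nu> (F \<omega>))\<^sup>2 \<partial>M) (Kkc_bdd B)"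

(* The weight is 0 where ehat vanishes (x / 0 = 0). *)
definition ipw_weight ::
  "(nat \<Rightarrow> 'w \<Rightarrow> 'x \<Rightarrow> real) \<Rightarrow> (nat \<Rightarrow> 'w \<Rightarrow> 'x) \<Rightarrow> (nat \<Rightarrow> 'w \<Rightarrow> real) \<Rightarrow>
    nat \<Rightarrow> 'w \<Rightarrow> nat \<Rightarrow> real" where
  "ipw_weight ehat Xs Ts n \<omega> i = Ts i \<omega> / ehat n \<omega> (Xs i \<omega>)"

(* If all weights vanish, every element of Kkc_bdd B is a minimiser and the choice is arbitrary. *)
definition ipw_frechet_mean ::
  "real \<Rightarrow> (nat \<Rightarrow> 'w \<Rightarrow> 'x \<Rightarrow> real) \<Rightarrow> (nat \<Rightarrow> 'w \<Rightarrow> 'a::euclidean_space set) \<Rightarrow>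
    (nat \<Rightarrow> 'w \<Rightarrow> 'x) \<Rightarrow> (nat \<Rightarrow> 'w \<Rightarrow> real) \<Rightarrow> nat \<Rightarrow> 'w \<Rightarrow> 'a set" where
  "ipw_frechet_mean B ehat Fs Xs Ts n \<omega> =
     arg_min_on (\<lambda>\<nu>. 1 / real n * (\<Sum>i<n. ipw_weight ehat Xs Ts n \<omega> i * (d_kc \<nu> (Fs i \<omega>))\<^sup>2))
       (Kkc_bdd B)"

definition set_scale :: "real \<Rightarrow> 'a::real_vector set \<Rightarrow> 'a set" where
  "set_scale t F = {t *\<^sub>R f | f. f \<in> F}"

(* Addition and finite sums of sets are the Minkowski ones of Set_Algebras. *)
definition weighted_minkowski_mean ::
  "nat \<Rightarrow> (nat \<Rightarrow> real) \<Rightarrow> (nat \<Rightarrow> 'a::euclidean_space set) \<Rightarrow> 'a set" where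
  "weighted_minkowski_mean n w F =
     set_scale (inverse (1 / real n * (\<Sum>i<n. w i)))
       (set_scale (1 / real n) (\<Sum>i<n. set_scale (w i) (F i)))"

(* Y n = O_p(r n).  Y n need not be measurable (e.g. an uncountable supremum), and measure M
   assigns 0 to non-measurable sets, so outer probability is used; it agrees with probability
   on events. *)
definition bigO_prob :: "'w measure \<Rightarrow> (nat \<Rightarrow> 'w \<Rightarrow> ennreal) \<Rightarrow> (nat \<Rightarrow> real) \<Rightarrow> bool" where
  "bigO_prob M Y r \<longleftrightarrow>
     (\<forall>\<epsilon>>0. \<exists>C>0. \<forall>\<^sub>F n in sequentially.
        outer_measure_of M {\<omega> \<in> space M. Y n \<omega> > ennreal (C * r n)} \<le> ennreal \<epsilon>)"

(* ennreal-valued because the difference may be unbounded on S. *)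
definition sup_dist :: "'x set \<Rightarrow> ('x \<Rightarrow> real) \<Rightarrow> ('x \<Rightarrow> real) \<Rightarrow> ennreal" where
  "sup_dist S f g = (SUP x\<in>S. ennreal \<bar>f x - g x\<bar>)"

definition fun_ball :: "'x set \<Rightarrow> ('x \<Rightarrow> real) set \<Rightarrow> ('x \<Rightarrow> real) \<Rightarrow> real \<Rightarrow> ('x \<Rightarrow> real) set" where
  "fun_ball S \<E> e \<gamma> = {g \<in> \<E>. sup_dist S e g < ennreal \<gamma>}"

(* The centres need not lie in A.  The value is \<infinity> if no finite cover exists. *)
definition covering_number :: "real \<Rightarrow> 'b set \<Rightarrow> ('b \<Rightarrow> 'b \<Rightarrow> ennreal) \<Rightarrow> enat" where
  "covering_number \<epsilon> A d =
     Inf {enat (card C) | C. finite C \<and> A \<subseteq> (\<Union>c\<in>C. {x. d c x < ennreal \<epsilon>})}"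

definition sqrt_log :: "enat \<Rightarrow> ennreal" where
  "sqrt_log N = (case N of enat k \<Rightarrow> ennreal (sqrt (ln (real k))) | \<infinity> \<Rightarrow> \<infinity>)"

definition entropy_integral ::
  "'x set \<Rightarrow> ('x \<Rightarrow> real) set \<Rightarrow> ('x \<Rightarrow> real) \<Rightarrow> real \<Rightarrow> real \<Rightarrow> ennreal" where
  "entropy_integral S \<E> e \<gamma> \<delta> =
     (\<integral>\<^sup>+\<epsilon>\<in>{0..1}. sqrt_log (covering_number (\<delta> * \<epsilon>) (fun_ball S \<E> e \<gamma>) (sup_dist S)) \<partial>lborel)"

end

theory Submission
  imports Defs
begin

text \<open>Support functions turn Minkowski sums and nonnegative multiples of convex bodies into sums and
  multiples of functions on the sphere, and by definition \<open>d_kc\<close> is the \<open>L\<^sup>2\<close> distance of support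
  functions.  Frechet means are therefore ordinary means in \<open>L\<^sup>2\<close>: the second moment about a point
  is the squared distance to the mean plus a term that does not depend on the point.  For finitely
  many bodies with nonnegative weights the minimiser is the weighted Minkowski mean
  (\<open>weighted_frechet_mean_eq_minkowski_mean\<close>); for a random body it is the body whose support function
  is the expected support function (\<open>expected_support_fun\<close>, \<open>frechet_mean_eq_expectation\<close>).

  Because estimator and target are both means in a Hilbert space, the error can be written down.  With
  \<open>w\<^sub>i = T\<^sub>i / ehat X\<^sub>i\<close> and \<open>a\<^sub>i = T\<^sub>i / e X\<^sub>i\<close>, and \<open>m\<close> the expected support function, the error at
  the direction \<open>p\<close> is \<open>(\<Sum>i. w\<^sub>i (s p F\<^sub>i - m p)) / (\<Sum>i. w\<^sub>i)\<close>.  Replacing \<open>w\<^sub>i\<close> by \<open>a\<^sub>i\<close> in the numerator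
  costs a bias of the order of the uniform error of \<open>ehat\<close>, uniformly in \<open>p\<close>, since the support
  functions are bounded and \<open>e\<close> stays away from \<open>0\<close> (\<open>weighted_minkowski_mean_perturbation\<close>).  What is left is an average of
  independent bounded terms.  They have mean zero: missingness at random makes the weight \<open>T / e X\<close>
  preserve the law of the body (\<open>weighted_expectation\<close>).  So the mean square of the average is at most a
  constant over \<open>n\<close>, and so is its integral over the sphere (\<open>fluctuation_mean\<close>).

  Altogether the error is of the order \<open>1 / sqrt n + \<rho> n\<close> in probability (\<open>ipw_frechet_mean_rate\<close>).  The
  exponent \<open>1 / (2 (1 + m))\<close> with \<open>m \<ge> 0\<close> is at most \<open>1 / 2\<close>, and \<open>x \<le> x powr \<theta>\<close> for \<open>0 \<le> x \<le> 1\<close> and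
  \<open>\<theta> \<le> 1\<close>, which gives the stated rate.\<close>

section \<open>Convex bodies and support functions\<close>

lemma KkcI: "F \<noteq> {} \<Longrightarrow> compact F \<Longrightarrow> convex F \<Longrightarrow> F \<in> Kkc"
  by (simp add: Kkc_def)

lemma support_fun_attained:
  assumes "F \<in> Kkc"
  obtains f where "f \<in> F" "support_fun p F = p \<bullet> f" "\<And>g. g \<in> F \<Longrightarrow> p \<bullet> g \<le> p \<bullet> f"
proof -
  have "continuous_on F (\<lambda>f. p \<bullet> f)"
    by (intro continuous_intros)
  then obtain f where f: "f \<in> F" "\<forall>g\<in>F. p \<bullet> g \<le> p \<bullet> f"
    using assms continuous_attains_sup[of F "\<lambda>f. p \<bullet> f"] by (auto simp: Kkc_def)
  have "support_fun p F = p \<bullet> f"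
    unfolding support_fun_def using f by (intro cSup_eq_maximum) auto
  with f show ?thesis
    by (intro that) auto
qed

lemma inner_le_support_fun: "F \<in> Kkc \<Longrightarrow> f \<in> F \<Longrightarrow> p \<bullet> f \<le> support_fun p F"
  by (metis support_fun_attained)

lemma support_fun_plus:
  assumes "F \<in> Kkc" "G \<in> Kkc"
  shows "support_fun p (F + G) = support_fun p F + support_fun p G"
proof -
  obtain f where f: "f \<in> F" "support_fun p F = p \<bullet> f" "\<And>g. g \<in> F \<Longrightarrow> p \<bullet> g \<le> p \<bullet> f"
    using assms support_fun_attained by metis
  obtain g where g: "g \<in> G" "support_fun p G = p \<bullet> g" "\<And>h. h \<in> G \<Longrightarrow> p \<bullet> h \<le> p \<bullet> g"
    using assms support_fun_attained by metis
  have "(SUP h\<in>F + G. p \<bullet> h) = p \<bullet> (f + g)"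
  proof (rule cSup_eq_maximum)
    show "p \<bullet> (f + g) \<in> (\<lambda>h. p \<bullet> h) ` (F + G)"
      using f(1) g(1) by (intro imageI set_plus_intro)
    show "y \<le> p \<bullet> (f + g)" if "y \<in> (\<lambda>h. p \<bullet> h) ` (F + G)" for y
      using that f(3) g(3) by (fastforce elim!: set_plus_elim simp: inner_add_right intro: add_mono)
  qed
  then show ?thesis
    by (simp add: support_fun_def[of p "F + G"] f(2) g(2) inner_add_right)
qed

lemma support_fun_set_scale:
  assumes "F \<in> Kkc" "0 \<le> t"
  shows "support_fun p (set_scale t F) = t * support_fun p F"
proof -
  obtain f where f: "f \<in> F" "support_fun p F = p \<bullet> f" "\<And>g. g \<in> F \<Longrightarrow> p \<bullet> g \<le> p \<bullet> f"
    using assms support_fun_attained by metis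
  have "(SUP h\<in>set_scale t F. p \<bullet> h) = p \<bullet> (t *\<^sub>R f)"
  proof (rule cSup_eq_maximum)
    show "p \<bullet> (t *\<^sub>R f) \<in> (\<lambda>h. p \<bullet> h) ` set_scale t F"
      using f(1) by (intro imageI) (auto simp: set_scale_def)
    show "y \<le> p \<bullet> (t *\<^sub>R f)" if "y \<in> (\<lambda>h. p \<bullet> h) ` set_scale t F" for y
      using that f(3) assms(2) by (auto simp: set_scale_def intro!: mult_left_mono)
  qed
  then show ?thesis
    by (simp add: support_fun_def[of p "set_scale t F"] f(2))
qed

lemma Kkc_plus:
  assumes "F \<in> Kkc" "G \<in> Kkc"
  shows "F + G \<in> Kkc"
proof -
  have "F + G = (\<Union>x\<in>F. \<Union>y\<in>G. {x + y})"
    by (auto simp: set_plus_def)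
  then show ?thesis
    using assms compact_sums'[of F G] convex_sums[of F G] by (auto simp: Kkc_def)
qed

lemma Kkc_set_scale: "F \<in> Kkc \<Longrightarrow> set_scale t F \<in> Kkc"
  using compact_scaling[of F t] convex_scaling[of F t]
  by (auto simp: Kkc_def set_scale_def Setcompr_eq_image)

lemma Kkc_sum: "(\<And>i. i \<in> I \<Longrightarrow> F i \<in> Kkc) \<Longrightarrow> (\<Sum>i\<in>I. F i) \<in> Kkc"
proof (induction I rule: infinite_finite_induct)
  case (insert i I)
  then show ?case by (simp add: Kkc_plus)
qed (auto simp: set_zero intro!: KkcI)

lemma support_fun_sum:
  "(\<And>i. i \<in> I \<Longrightarrow> F i \<in> Kkc) \<Longrightarrow> support_fun p (\<Sum>i\<in>I. F i) = (\<Sum>i\<in>I. support_fun p (F i))"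
proof (induction I rule: infinite_finite_induct)
  case (insert i I)
  then show ?case by (simp add: support_fun_plus Kkc_sum)
qed (auto simp: set_zero support_fun_def)

text \<open>A point outside a closed convex set is cut off by a half-space, and the normal of that
  half-space is a direction in which the support function sees the difference.\<close>

lemma subset_if_support_fun_le:
  assumes F: "F \<in> Kkc" and G: "G \<in> Kkc" and le: "\<And>p. support_fun p F \<le> support_fun p G"
  shows "F \<subseteq> G"
proof
  fix f assume "f \<in> F"
  show "f \<in> G"
  proof (rule ccontr)
    assume "f \<notin> G"
    moreover have "convex G" "closed G"
      using G by (auto simp: Kkc_def compact_imp_closed)
    ultimately obtain a b where ab: "a \<bullet> f < b" "\<And>x. x \<in> G \<Longrightarrow> b < a \<bullet> x"
      using separating_hyperplane_closed_point by metis
    obtain g where g: "g \<in> G" "support_fun (- a) G = - a \<bullet> g"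
      using G support_fun_attained by metis
    have "- a \<bullet> f \<le> support_fun (- a) G"
      using inner_le_support_fun[OF F \<open>f \<in> F\<close>] le order.trans by blast
    with g ab show False
      by fastforce
  qed
qed

lemma support_fun_inject:
  "F \<in> Kkc \<Longrightarrow> G \<in> Kkc \<Longrightarrow> (\<And>p. support_fun p F = support_fun p G) \<Longrightarrow> F = G"
  by (intro equalityI subset_if_support_fun_le) auto

lemma Kkc_bdd_iff: "F \<in> Kkc_bdd B \<longleftrightarrow> F \<in> Kkc \<and> (\<forall>f\<in>F. norm f \<le> B)"
proof (cases "F \<in> Kkc")
  case True
  then have F: "F \<noteq> {}" "bounded F"
    by (auto simp: Kkc_def compact_imp_bounded)
  have "bdd_above (norm ` F)"
    using F(2) by (auto simp: bdd_above_def bounded_iff)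
  then show ?thesis
    using True F(1) by (simp add: Kkc_bdd_def cSUP_le_iff)
qed (simp add: Kkc_bdd_def)

lemma Kkc_bddD: "F \<in> Kkc_bdd B \<Longrightarrow> F \<in> Kkc"
  by (simp add: Kkc_bdd_def)

lemma Kkc_bdd_if_support_fun_le:
  assumes F: "F \<in> Kkc" and B: "0 \<le> B" and le: "\<And>p. norm p = 1 \<Longrightarrow> support_fun p F \<le> B"
  shows "F \<in> Kkc_bdd B"
proof -
  have "norm f \<le> B" if "f \<in> F" for f
  proof (cases "f = 0")
    case False
    then have "norm f = sgn f \<bullet> f"
      by (simp add: sgn_div_norm dot_square_norm power2_eq_square)
    also have "\<dots> \<le> support_fun (sgn f) F"
      using F that by (rule inner_le_support_fun)
    also have "\<dots> \<le> B"
      using False by (intro le) (simp add: norm_sgn)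
    finally show ?thesis .
  qed (use B in simp)
  then show ?thesis
    using F by (simp add: Kkc_bdd_iff)
qed

lemma support_fun_scaleR:
  assumes "F \<in> Kkc" "0 \<le> c"
  shows "support_fun (c *\<^sub>R p) F = c * support_fun p F"
proof -
  obtain f where f: "f \<in> F" "support_fun p F = p \<bullet> f" "\<And>g. g \<in> F \<Longrightarrow> p \<bullet> g \<le> p \<bullet> f"
    using assms support_fun_attained by metis
  have "(SUP h\<in>F. c *\<^sub>R p \<bullet> h) = c *\<^sub>R p \<bullet> f"
    using f(1,3) assms(2) by (intro cSup_eq_maximum) (auto intro!: mult_left_mono)
  then show ?thesis
    by (simp add: support_fun_def[of "c *\<^sub>R p"] f(2))
qed

lemma support_fun_add_le:
  assumes "F \<in> Kkc"
  shows "support_fun (p + q) F \<le> support_fun p F + support_fun q F"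
proof -
  obtain f where "f \<in> F" "support_fun (p + q) F = (p + q) \<bullet> f"
    using assms support_fun_attained by metis
  then show ?thesis
    using inner_le_support_fun[OF assms, of f p] inner_le_support_fun[OF assms, of f q]
    by (simp add: inner_add_left)
qed

lemma support_fun_le_norm:
  assumes "F \<in> Kkc_bdd B"
  shows "support_fun p F \<le> B * norm p"
proof -
  obtain f where "f \<in> F" "support_fun p F = p \<bullet> f"
    using assms support_fun_attained Kkc_bddD by metis
  moreover have "norm f \<le> B"
    using assms \<open>f \<in> F\<close> by (simp add: Kkc_bdd_iff)
  ultimately show ?thesis
    using norm_cauchy_schwarz[of p f] mult_left_mono[of "norm f" B "norm p"]
    by (simp add: mult.commute)
qed

lemma support_fun_lipschitz:
  assumes "F \<in> Kkc_bdd B"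
  shows "\<bar>support_fun p F - support_fun q F\<bar> \<le> B * dist p q"
proof -
  have "support_fun p F - support_fun q F \<le> B * dist p q" for p q
    using support_fun_add_le[OF Kkc_bddD[OF assms], of "p - q" q]
      support_fun_le_norm[OF assms, of "p - q"] by (simp add: dist_norm)
  from this[of p q] this[of q p] show ?thesis
    by (simp add: dist_commute abs_le_iff)
qed

lemma support_fun_abs_le:
  assumes "F \<in> Kkc_bdd B"
  shows "\<bar>support_fun p F\<bar> \<le> B * norm p"
proof -
  have "support_fun 0 F = 0"
    using support_fun_scaleR[OF Kkc_bddD[OF assms], of 0 p] by simp
  with support_fun_lipschitz[OF assms, of p 0] show ?thesis
    by simp
qed

lemma support_fun_inject_sphere:
  assumes F: "F \<in> Kkc" and G: "G \<in> Kkc"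
    and eq: "\<And>p. norm p = 1 \<Longrightarrow> support_fun p F = support_fun p G"
  shows "F = G"
proof (rule support_fun_inject[OF F G])
  fix p
  show "support_fun p F = support_fun p G"
  proof (cases "p = 0")
    case True
    then show ?thesis
      using support_fun_scaleR[OF F, of 0 p] support_fun_scaleR[OF G, of 0 p] by simp
  next
    case False
    then have "p = norm p *\<^sub>R sgn p"
      by (simp add: sgn_div_norm)
    moreover have "support_fun (sgn p) F = support_fun (sgn p) G"
      using False by (intro eq) (simp add: norm_sgn)
    ultimately show ?thesis
      by (metis F G norm_ge_zero support_fun_scaleR)
  qed
qed

text \<open>A point strictly below the graph is separated from the epigraph, a closed convex cone; rescaling
  the separating functional so that its last coordinate is \<open>1\<close> gives a linear minorant, that is, an
  element of the set, which comes as close to the value of the function as desired.\<close>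

lemma sublinear_is_support_fun:
  fixes m :: "'a::euclidean_space \<Rightarrow> real"
  assumes add: "\<And>p q. m (p + q) \<le> m p + m q"
    and scale: "\<And>c p. 0 \<le> c \<Longrightarrow> m (c *\<^sub>R p) = c * m p"
    and bound: "\<And>p. m p \<le> B * norm p" and B: "0 \<le> B"
  obtains G where "G \<in> Kkc_bdd B" "\<And>p. support_fun p G = m p"
proof -
  define G where "G = {x. \<forall>p. p \<bullet> x \<le> m p}"
  define E where "E = {z. m (fst z) \<le> snd z}"
  have m_diff: "m p - m q \<le> B * dist p q" for p q
    using add[of "p - q" q] bound[of "p - q"] by (simp add: dist_norm)
  have lip: "B-lipschitz_on UNIV m"
    by (rule lipschitz_onI) (use m_diff B in \<open>force simp: dist_real_def abs_le_iff dist_commute\<close>)+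
  then have "continuous_on UNIV m"
    by (rule lipschitz_on_continuous_on)
  then have cont: "continuous_on UNIV (\<lambda>z::'a \<times> real. m (fst z))"
    by (rule continuous_on_compose2) (auto intro: continuous_intros)
  have E_closed: "closed E"
    unfolding E_def by (intro closed_Collect_le cont continuous_intros)
  have E_convex: "convex E"
  proof (rule convexI)
    fix x y :: "'a \<times> real" and u v :: real
    assume x: "x \<in> E" and y: "y \<in> E" and uv: "0 \<le> u" "0 \<le> v" "u + v = 1"
    have "m (u *\<^sub>R fst x + v *\<^sub>R fst y) \<le> u * m (fst x) + v * m (fst y)"
      using add[of "u *\<^sub>R fst x" "v *\<^sub>R fst y"] uv by (simp add: scale)
    also have "\<dots> \<le> u * snd x + v * snd y"
      using x y uv by (intro add_mono mult_left_mono) (auto simp: E_def)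
    finally show "u *\<^sub>R x + v *\<^sub>R y \<in> E"
      by (simp add: E_def)
  qed
  have minorant: "\<exists>x\<in>G. r < p \<bullet> x" if "r < m p" for p r
  proof -
    have "(p, r) \<notin> E"
      using that by (simp add: E_def)
    then obtain z b where z: "z \<bullet> (p, r) < b" "\<And>y. y \<in> E \<Longrightarrow> b < z \<bullet> y"
      using separating_hyperplane_closed_point[OF E_convex E_closed] by metis
    obtain a \<alpha> where [simp]: "z = (a, \<alpha>)"
      by (cases z)
    have m0: "m 0 = 0"
      using scale[of 0 0] by simp
    have "b < 0"
      using z(2)[of "(0, 0)"] by (simp add: E_def m0)
    \<comment> \<open>A linear functional bounded below on a cone is nonnegative on it.\<close>
    have E_nonneg: "0 \<le> z \<bullet> y" if "y \<in> E" for y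
    proof (rule ccontr)
      assume "\<not> 0 \<le> z \<bullet> y"
      then have neg: "z \<bullet> y < 0" by simp
      define c where "c = b / (z \<bullet> y)"
      have "0 \<le> c"
        using neg \<open>b < 0\<close> by (simp add: c_def divide_nonpos_neg)
      then have "c *\<^sub>R y \<in> E"
        using that by (simp add: E_def scale mult_left_mono)
      from z(2)[OF this] neg show False
        by (simp add: c_def inner_scaleR_right del: inner_Pair)
    qed
    have "0 \<le> \<alpha>"
      using E_nonneg[of "(0, 1)"] by (simp add: E_def m0)
    \<comment> \<open>Every \<open>p\<close> occurs as a first coordinate in the epigraph, so a vertical hyperplane cannot separate.\<close>
    moreover have "\<alpha> \<noteq> 0"
    proof
      assume "\<alpha> = 0"
      then have "0 \<le> a \<bullet> (- a)"
        using E_nonneg[of "(- a, m (- a))"] by (simp add: E_def)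
      then have "a = 0"
        by (metis inner_ge_zero inner_minus_right inner_eq_zero_iff neg_0_le_iff_le order_antisym)
      with \<open>\<alpha> = 0\<close> z(1) \<open>b < 0\<close> show False by simp
    qed
    ultimately have "0 < \<alpha>" by simp
    define x where "x = - (1 / \<alpha>) *\<^sub>R a"
    have "x \<in> G"
    proof -
      have "q \<bullet> x \<le> m q" for q
      proof -
        have "0 \<le> a \<bullet> q + \<alpha> * m q"
          using E_nonneg[of "(q, m q)"] by (simp add: E_def)
        then show ?thesis
          using \<open>0 < \<alpha>\<close> by (simp add: x_def field_simps inner_commute)
      qed
      then show ?thesis by (simp add: G_def)
    qed
    moreover have "r < p \<bullet> x"
    proof -
      have "a \<bullet> p + \<alpha> * r < 0"
        using z(1) \<open>b < 0\<close> by simp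
      then show ?thesis
        using \<open>0 < \<alpha>\<close> by (simp add: x_def field_simps inner_commute)
    qed
    ultimately show ?thesis by blast
  qed
  have "G \<noteq> {}"
    using minorant[of "m 0 - 1" 0] by auto
  moreover have G_le: "norm x \<le> B" if "x \<in> G" for x
  proof (cases "x = 0")
    case False
    have "x \<bullet> x \<le> B * norm x"
      using that bound[of x] by (auto simp: G_def intro: order.trans)
    then show ?thesis
      using False by (simp add: dot_square_norm power2_eq_square)
  qed (use B in simp)
  moreover have "closed G"
    unfolding G_def by (intro closed_Collect_all closed_Collect_le continuous_intros)
  moreover have "convex G"
  proof -
    have "G = (\<Inter>p. {x. p \<bullet> x \<le> m p})"
      by (auto simp: G_def)
    then show ?thesis
      by (simp add: convex_INT convex_halfspace_le)
  qed
  moreover have "bounded G"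
    using G_le by (auto simp: bounded_iff)
  ultimately have GB: "G \<in> Kkc_bdd B"
    by (auto simp: Kkc_bdd_iff Kkc_def compact_eq_bounded_closed)
  have "support_fun p G = m p" for p
  proof (rule antisym)
    obtain x where "x \<in> G" "support_fun p G = p \<bullet> x"
      using GB Kkc_bddD support_fun_attained by metis
    then show "support_fun p G \<le> m p"
      by (simp add: G_def)
    show "m p \<le> support_fun p G"
    proof (rule dense_le)
      fix r assume "r < m p"
      then obtain x where "x \<in> G" "r < p \<bullet> x"
        using minorant by blast
      with inner_le_support_fun[OF Kkc_bddD[OF GB]] show "r \<le> support_fun p G"
        by (meson less_imp_le order.trans)
    qed
  qed
  with GB that show ?thesis by blast
qed

section \<open>The sphere measure and the metric\<close>

lemma sets_sphere_measure [measurable_cong]: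
  "sets (sphere_measure :: 'a::euclidean_space measure) = sets (restrict_space borel (sphere 0 1))"
  by (simp add: sphere_measure_def)

lemma space_sphere_measure [simp]:
  "space (sphere_measure :: 'a::euclidean_space measure) = sphere 0 1"
  by (simp add: sphere_measure_def space_scale_measure space_restrict_space)

lemma measurable_sgn_punctured_ball:
  "(sgn :: 'a::euclidean_space \<Rightarrow> 'a) \<in> restrict_space lborel (cball 0 1 - {0}) \<rightarrow>\<^sub>M
     restrict_space borel (sphere 0 1)"
proof (rule measurable_restrict_space2)
  have "continuous_on (cball 0 1 - {0}) (sgn :: 'a \<Rightarrow> 'a)"
    by (intro continuous_intros) auto
  then have "sgn \<in> borel_measurable (restrict_space borel (cball 0 1 - {0 :: 'a}))"
    by (rule borel_measurable_continuous_on_restrict)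
  then show "sgn \<in> borel_measurable (restrict_space lborel (cball 0 1 - {0 :: 'a}))"
    by (subst measurable_cong_sets[where N' = borel]) (auto cong: sets_restrict_space_cong)
qed (auto simp: space_restrict_space norm_sgn)

lemma emeasure_sphere_measure:
  assumes "A \<in> sets (restrict_space borel (sphere 0 1 :: 'a::euclidean_space set))"
  shows "emeasure sphere_measure A = of_nat DIM('a) * emeasure lborel {x \<in> cball 0 1 - {0}. sgn x \<in> A}"
proof -
  have eq: "sgn -` A \<inter> space (restrict_space lborel (cball 0 1 - {0}))
      = {x \<in> cball 0 1 - {0 :: 'a}. sgn x \<in> A}"
    by (auto simp: space_restrict_space)
  show ?thesis
    unfolding sphere_measure_def emeasure_scale_measure
      emeasure_distr[OF measurable_sgn_punctured_ball assms] eq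
    by (subst emeasure_restrict_space) auto
qed

lemma finite_measure_sphere_measure: "finite_measure (sphere_measure :: 'a::euclidean_space measure)"
proof (rule finite_measureI)
  have "emeasure sphere_measure (space sphere_measure :: 'a set)
      = of_nat DIM('a) * emeasure lborel {x \<in> cball 0 1 - {0 :: 'a}. sgn x \<in> sphere 0 1}"
    by (subst emeasure_sphere_measure) (auto simp: sets_restrict_space)
  also have "\<dots> \<le> of_nat DIM('a) * emeasure lborel (cball (0 :: 'a) 1)"
    by (intro mult_left_mono emeasure_mono) auto
  also have "\<dots> < \<infinity>"
    by (simp add: ennreal_mult_less_top of_nat_less_top emeasure_bounded_finite[simplified])
  finally show "emeasure sphere_measure (space sphere_measure :: 'a set) \<noteq> \<infinity>"
    by simp
qed

interpretation sphere: finite_measure "sphere_measure :: 'a::euclidean_space measure"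
  by (rule finite_measure_sphere_measure)

text \<open>Relatively open subsets of the sphere carry mass because the open cone over them does.\<close>

lemma sphere_measure_open_pos:
  fixes U :: "'a::euclidean_space set"
  assumes "open U" "p \<in> U" "norm p = 1"
  shows "0 < measure sphere_measure (U \<inter> sphere 0 1)"
proof -
  \<comment> \<open>The unit ball is taken open here so that the cone is open.\<close>
  define V where "V = {x \<in> ball 0 1 - {0 :: 'a}. sgn x \<in> U}"
  have "continuous_on (ball 0 1 - {0}) (sgn :: 'a \<Rightarrow> 'a)"
    by (intro continuous_intros) auto
  then have "open (sgn -` U \<inter> (ball 0 1 - {0 :: 'a}))"
    using assms(1) by (subst (asm) continuous_on_open_vimage) auto
  moreover have "sgn -` U \<inter> (ball 0 1 - {0 :: 'a}) = V"
    by (auto simp: V_def)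
  ultimately have "open V" by simp
  moreover have "(1 / 2) *\<^sub>R p \<in> V"
    using assms(2,3) by (auto simp: V_def sgn_div_norm)
  ultimately have "emeasure lborel V \<noteq> 0"
    using open_not_negligible[of V] by (auto simp: negligible_iff_null_sets null_sets_completionI null_sets_def)
  moreover have "V \<subseteq> {x \<in> cball 0 1 - {0}. sgn x \<in> U \<inter> sphere 0 1}"
    by (auto simp: V_def norm_sgn)
  moreover have meas: "U \<inter> sphere 0 1 \<in> sets (restrict_space borel (sphere 0 1))"
    using assms(1) by (auto simp: sets_restrict_space)
  moreover have "{x \<in> cball 0 1 - {0 :: 'a}. sgn x \<in> U \<inter> sphere 0 1} \<in> sets lborel"
    using measurable_sets[OF measurable_sgn_punctured_ball meas]
    by (auto simp: space_restrict_space sets_restrict_space_iff vimage_def Int_def conj_commute conj_left_commute)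
  ultimately have "emeasure sphere_measure (U \<inter> sphere 0 1) \<noteq> 0"
    using emeasure_mono[of V "{x \<in> cball 0 1 - {0}. sgn x \<in> U \<inter> sphere 0 1}" lborel]
    by (auto simp: emeasure_sphere_measure)
  then show ?thesis
    by (simp add: sphere.emeasure_eq_measure zero_less_measure_iff)
qed

lemma borel_measurable_sphere_continuous:
  "continuous_on (sphere 0 1) f \<Longrightarrow> f \<in> borel_measurable (sphere_measure :: 'a::euclidean_space measure)"
  by (subst measurable_cong_sets[OF sets_sphere_measure refl])
     (rule borel_measurable_continuous_on_restrict)

lemma continuous_on_support_fun:
  assumes "F \<in> Kkc_bdd B"
  shows "continuous_on A (\<lambda>p. support_fun p F)"
proof (rule lipschitz_on_continuous_on)
  obtain f where "f \<in> F" "norm f \<le> B"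
    using assms by (auto simp: Kkc_bdd_iff Kkc_def)
  then have "0 \<le> B"
    using norm_ge_zero order.trans by blast
  then show "B-lipschitz_on A (\<lambda>p. support_fun p F)"
    using support_fun_lipschitz[OF assms] by (intro lipschitz_onI) (auto simp: dist_real_def)
qed

lemma support_fun_measurable_sphere [measurable]:
  "F \<in> Kkc_bdd B \<Longrightarrow> (\<lambda>p. support_fun p F) \<in> borel_measurable sphere_measure"
  by (intro borel_measurable_sphere_continuous continuous_on_support_fun)

lemma support_fun_abs_le_sphere: "F \<in> Kkc_bdd B \<Longrightarrow> p \<in> sphere 0 1 \<Longrightarrow> \<bar>support_fun p F\<bar> \<le> B"
  using support_fun_abs_le[of F B p] by simp

lemma integrable_sphere_bounded:
  fixes f :: "'a::euclidean_space \<Rightarrow> real"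
  assumes "f \<in> borel_measurable sphere_measure" "\<And>p. p \<in> sphere 0 1 \<Longrightarrow> \<bar>f p\<bar> \<le> b"
  shows "integrable sphere_measure f"
  using assms by (intro sphere.integrable_const_bound[of _ b]) (auto intro: AE_I2)

lemma d_kc_nonneg [simp]: "0 \<le> d_kc F G"
  by (simp add: d_kc_def)

lemma d_kc_power2: "(d_kc F G)\<^sup>2 = (\<integral>p. (support_fun p F - support_fun p G)\<^sup>2 \<partial>sphere_measure)"
  by (simp add: d_kc_def)

lemma d_kc_commute: "d_kc F G = d_kc G F"
  by (simp add: d_kc_def power2_commute)

lemma d_kc_self [simp]: "d_kc F F = 0"
  by (simp add: d_kc_def)

lemma abs_diff_power2_le: "\<bar>x :: real\<bar> \<le> b \<Longrightarrow> \<bar>y\<bar> \<le> b \<Longrightarrow> \<bar>(x - y)\<^sup>2\<bar> \<le> (2 * b)\<^sup>2"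
  by (simp only: abs_power2 abs_le_square_iff[symmetric])

lemma integrable_support_fun_diff_power2:
  assumes F: "F \<in> Kkc_bdd B" and G: "G \<in> Kkc_bdd B"
  shows "integrable sphere_measure (\<lambda>p. (support_fun p F - support_fun p G)\<^sup>2)"
  using assms
  by (intro integrable_sphere_bounded[of _ "(2 * B)\<^sup>2"] abs_diff_power2_le support_fun_abs_le_sphere
      borel_measurable_power borel_measurable_diff support_fun_measurable_sphere)

text \<open>Minkowski's inequality in \<open>L\<^sup>2\<close>, from the weighted inequality
  \<open>(f + g)\<^sup>2 \<le> (1 + t) f\<^sup>2 + (1 + 1 / t) g\<^sup>2\<close> with \<open>t\<close> the ratio of two numbers just above the norms
  of \<open>g\<close> and \<open>f\<close>; the slack covers vanishing norms.\<close>

lemma L2_triangle: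
  fixes f g :: "'b \<Rightarrow> real"
  assumes f: "integrable M (\<lambda>x. (f x)\<^sup>2)" and g: "integrable M (\<lambda>x. (g x)\<^sup>2)"
  shows "sqrt (\<integral>x. (f x + g x)\<^sup>2 \<partial>M) \<le> sqrt (\<integral>x. (f x)\<^sup>2 \<partial>M) + sqrt (\<integral>x. (g x)\<^sup>2 \<partial>M)"
proof (rule field_le_epsilon)
  fix \<epsilon> :: real assume "0 < \<epsilon>"
  define a where "a = sqrt (\<integral>x. (f x)\<^sup>2 \<partial>M) + \<epsilon> / 2"
  define b where "b = sqrt (\<integral>x. (g x)\<^sup>2 \<partial>M) + \<epsilon> / 2"
  have a: "0 < a" and b: "0 < b"
    using \<open>0 < \<epsilon>\<close> by (auto simp: a_def b_def intro!: add_nonneg_pos)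
  have fa: "(\<integral>x. (f x)\<^sup>2 \<partial>M) \<le> a\<^sup>2"
    by (rule sqrt_le_D) (use \<open>0 < \<epsilon>\<close> in \<open>simp add: a_def\<close>)
  have gb: "(\<integral>x. (g x)\<^sup>2 \<partial>M) \<le> b\<^sup>2"
    by (rule sqrt_le_D) (use \<open>0 < \<epsilon>\<close> in \<open>simp add: b_def\<close>)
  have pointwise: "(x + y)\<^sup>2 \<le> (1 + b / a) * x\<^sup>2 + (1 + a / b) * y\<^sup>2" for x y :: real
  proof -
    have "(1 + b / a) * x\<^sup>2 + (1 + a / b) * y\<^sup>2 - (x + y)\<^sup>2 = (b * x - a * y)\<^sup>2 / (a * b)"
      using a b by (simp add: field_simps power2_eq_square)
    also have "0 \<le> \<dots>"
      using a b by simp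
    finally show ?thesis by simp
  qed
  have "(\<integral>x. (f x + g x)\<^sup>2 \<partial>M) \<le> (\<integral>x. (1 + b / a) * (f x)\<^sup>2 + (1 + a / b) * (g x)\<^sup>2 \<partial>M)"
    using f g pointwise a b by (intro integral_mono_AE' ) (auto intro!: AE_I2 add_nonneg_nonneg mult_nonneg_nonneg)
  also have "\<dots> = (1 + b / a) * (\<integral>x. (f x)\<^sup>2 \<partial>M) + (1 + a / b) * (\<integral>x. (g x)\<^sup>2 \<partial>M)"
    using f g by simp
  also have "\<dots> \<le> (1 + b / a) * a\<^sup>2 + (1 + a / b) * b\<^sup>2"
    using fa gb a b by (intro add_mono mult_left_mono) (auto intro!: add_nonneg_nonneg)
  also have "\<dots> = (a + b)\<^sup>2"
    using a b by (simp add: field_simps power2_eq_square)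
  finally have "sqrt (\<integral>x. (f x + g x)\<^sup>2 \<partial>M) \<le> a + b"
    using a b by (intro real_le_lsqrt) auto
  then show "sqrt (\<integral>x. (f x + g x)\<^sup>2 \<partial>M)
      \<le> sqrt (\<integral>x. (f x)\<^sup>2 \<partial>M) + sqrt (\<integral>x. (g x)\<^sup>2 \<partial>M) + \<epsilon>"
    by (simp add: a_def b_def)
qed

lemma d_kc_triangle:
  assumes "F \<in> Kkc_bdd B" "G \<in> Kkc_bdd B" "H \<in> Kkc_bdd B"
  shows "d_kc F H \<le> d_kc F G + d_kc G H"
  using L2_triangle[OF integrable_support_fun_diff_power2[OF assms(1,2)]
      integrable_support_fun_diff_power2[OF assms(2,3)]]
  by (simp add: d_kc_def)

text \<open>Support functions of sets in a fixed ball are equi-Lipschitz, so a gap at one direction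
  persists on a whole cap and shows up in the \<open>L\<^sup>2\<close> distance.\<close>

lemma support_fun_uniformly_continuous_d_kc:
  fixes p :: "'a::euclidean_space"
  assumes B: "0 < B" and p: "norm p = 1" and "0 < \<epsilon>"
  obtains \<delta> where "0 < \<delta>"
    "\<And>F G. F \<in> Kkc_bdd B \<Longrightarrow> G \<in> Kkc_bdd B \<Longrightarrow> d_kc F G < \<delta> \<Longrightarrow>
       \<bar>support_fun p F - support_fun p G\<bar> < \<epsilon>"
proof
  \<comment> \<open>On a cap of this radius both support functions together vary by at most \<open>\<epsilon> / 2\<close>.\<close>
  define U where "U = ball p (\<epsilon> / (4 * B)) \<inter> sphere 0 1"
  define c where "c = measure sphere_measure U"
  have c: "0 < c"
    unfolding c_def U_def using B p \<open>0 < \<epsilon>\<close> by (intro sphere_measure_open_pos[of _ p]) auto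
  have U: "U \<in> sets sphere_measure"
    unfolding U_def sets_sphere_measure by (auto simp: sets_restrict_space)
  show "0 < sqrt ((\<epsilon> / 2)\<^sup>2 * c)"
    using c \<open>0 < \<epsilon>\<close> by simp
  fix F G :: "'a set" assume F: "F \<in> Kkc_bdd B" and G: "G \<in> Kkc_bdd B"
  assume less: "d_kc F G < sqrt ((\<epsilon> / 2)\<^sup>2 * c)"
  show "\<bar>support_fun p F - support_fun p G\<bar> < \<epsilon>"
  proof (rule ccontr)
    assume gap: "\<not> \<bar>support_fun p F - support_fun p G\<bar> < \<epsilon>"
    have "\<epsilon> / 2 \<le> \<bar>support_fun q F - support_fun q G\<bar>" if "q \<in> U" for q
    proof -
      have "B * dist p q \<le> B * (\<epsilon> / (4 * B))"
        using that B by (intro mult_left_mono) (auto simp: U_def)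
      then have "B * dist p q \<le> \<epsilon> / 4"
        using B by simp
      with gap support_fun_lipschitz[OF F, of p q] support_fun_lipschitz[OF G, of p q]
      show ?thesis by linarith
    qed
    then have "(\<epsilon> / 2)\<^sup>2 \<le> (support_fun q F - support_fun q G)\<^sup>2" if "q \<in> U" for q
      using that \<open>0 < \<epsilon>\<close> by (subst abs_le_square_iff[symmetric]) auto
    then have "(\<integral>q. (\<epsilon> / 2)\<^sup>2 * indicator U q \<partial>sphere_measure)
        \<le> (\<integral>q. (support_fun q F - support_fun q G)\<^sup>2 \<partial>sphere_measure)"
      using U by (intro integral_mono integrable_support_fun_diff_power2[OF F G]
          integrable_mult_right sphere.integrable_const_bound[of _ 1])
        (auto simp: indicator_def)
    then have "(\<epsilon> / 2)\<^sup>2 * c \<le> (d_kc F G)\<^sup>2"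
      using U Int_absorb2[of U "sphere 0 1"]
      by (simp add: c_def d_kc_power2 mult.commute) (simp add: U_def)
    then have "sqrt ((\<epsilon> / 2)\<^sup>2 * c) \<le> d_kc F G"
      by (intro real_le_lsqrt) auto
    with less show False by simp
  qed
qed

lemma d_kc_eq_0_iff:
  assumes B: "0 < B" and F: "F \<in> Kkc_bdd B" and G: "G \<in> Kkc_bdd B"
  shows "d_kc F G = 0 \<longleftrightarrow> F = G"
proof
  assume zero: "d_kc F G = 0"
  have "support_fun p F = support_fun p G" if "norm p = 1" for p
  proof -
    have "\<bar>support_fun p F - support_fun p G\<bar> < \<epsilon>" if "0 < \<epsilon>" for \<epsilon>
      using support_fun_uniformly_continuous_d_kc[OF B \<open>norm p = 1\<close> that] F G zero by metis
    then show ?thesis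
      by (metis abs_ge_zero eq_iff_diff_eq_0 less_irrefl zero_less_abs_iff)
  qed
  then show "F = G"
    using F G by (intro support_fun_inject_sphere) (auto dest: Kkc_bddD)
qed simp

lemma Metric_space_Kkc_bdd:
  assumes "0 < B"
  shows "Metric_space (Kkc_bdd B :: 'a::euclidean_space set set) d_kc"
  using assms by unfold_locales (auto simp: d_kc_commute d_kc_eq_0_iff intro: d_kc_triangle)

section \<open>Measurability of support functions\<close>

lemma space_Kkc_borel [simp]: "space (Kkc_borel B) = Kkc_bdd B"
  by (simp add: Kkc_borel_def space_measure_of_conv)

lemma open_in_Kkc_borel:
  fixes U :: "'a::euclidean_space set set"
  assumes B: "0 < B" and U: "U \<subseteq> Kkc_bdd B"
    and open_U: "\<And>F. F \<in> U \<Longrightarrow> \<exists>r>0. \<forall>G\<in>Kkc_bdd B. d_kc F G < r \<longrightarrow> G \<in> U"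
  shows "U \<in> sets (Kkc_borel B)"
proof -
  interpret Metric_space "Kkc_bdd B :: 'a set set" d_kc
    by (rule Metric_space_Kkc_bdd[OF B])
  have "openin mtopology U"
    unfolding openin_mtopology
  proof (intro conjI allI impI U)
    fix F assume "F \<in> U"
    then obtain r where "0 < r" "\<forall>G\<in>Kkc_bdd B. d_kc F G < r \<longrightarrow> G \<in> U"
      using open_U by blast
    then show "\<exists>r>0. mball F r \<subseteq> U"
      by (auto simp: mball_def)
  qed
  moreover have "{U. openin mtopology U} \<subseteq> Pow (Kkc_bdd B :: 'a set set)"
    by (auto simp: openin_mtopology)
  ultimately show ?thesis
    by (auto simp: Kkc_borel_def sets_measure_of)
qed

lemma borel_measurable_Kkc_borel_continuous:
  fixes h :: "'a::euclidean_space set \<Rightarrow> real"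
  assumes B: "0 < B"
    and cont: "\<And>F \<epsilon>. F \<in> Kkc_bdd B \<Longrightarrow> 0 < \<epsilon> \<Longrightarrow>
      \<exists>r>0. \<forall>G\<in>Kkc_bdd B. d_kc F G < r \<longrightarrow> \<bar>h F - h G\<bar> < \<epsilon>"
  shows "h \<in> borel_measurable (Kkc_borel B)"
  unfolding borel_measurable_iff_greater
proof
  fix a
  show "{w \<in> space (Kkc_borel B). a < h w} \<in> sets (Kkc_borel B)"
  proof (rule open_in_Kkc_borel[OF B])
    fix F assume F: "F \<in> {w \<in> space (Kkc_borel B). a < h w}"
    then obtain r where "0 < r" "\<forall>G\<in>Kkc_bdd B. d_kc F G < r \<longrightarrow> \<bar>h F - h G\<bar> < h F - a"
      using cont[of F "h F - a"] by auto
    then show "\<exists>r>0. \<forall>G\<in>Kkc_bdd B. d_kc F G < r \<longrightarrow> G \<in> {w \<in> space (Kkc_borel B). a < h w}"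
      by (intro exI[of _ r]) fastforce
  qed auto
qed

lemma support_fun_measurable_Kkc_borel:
  fixes p :: "'a::euclidean_space"
  assumes B: "0 < B" and p: "norm p = 1"
  shows "support_fun p \<in> borel_measurable (Kkc_borel B)"
proof (rule borel_measurable_Kkc_borel_continuous[OF B])
  fix F :: "'a set" and \<epsilon> :: real assume F: "F \<in> Kkc_bdd B" and "0 < \<epsilon>"
  then show "\<exists>r>0. \<forall>G\<in>Kkc_bdd B. d_kc F G < r \<longrightarrow> \<bar>support_fun p F - support_fun p G\<bar> < \<epsilon>"
    using support_fun_uniformly_continuous_d_kc[OF B p \<open>0 < \<epsilon>\<close>] by metis
qed

text \<open>The equi-Lipschitz bound also gives joint measurability, since it recovers the support function
  from its values on a countable dense set of directions by an infimal convolution.\<close>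

lemma support_fun_measurable_pair:
  assumes B: "0 < B"
  shows "(\<lambda>(p :: 'a::euclidean_space, F). support_fun p F) \<in> borel_measurable (sphere_measure \<Otimes>\<^sub>M Kkc_borel B)"
proof -
  obtain D :: "'a set" where D: "countable D" "D \<subseteq> sphere 0 1" "sphere 0 1 \<subseteq> closure D"
    using separable by metis
  obtain v :: 'a where "v \<in> sphere 0 1"
    using vector_choose_size[of 1] by (metis mem_sphere_0 zero_le_one)
  then have "D \<noteq> {}"
    using D(3) by auto
  define h where "h = (\<lambda>z. INF q\<in>D. support_fun q (snd z) + B * dist (fst z) q)"
  have lower: "support_fun p F \<le> support_fun q F + B * dist p q" if "F \<in> Kkc_bdd B" for p q F
    using support_fun_lipschitz[OF that, of p q] by linarith
  have eq: "h (p, F) = support_fun p F" if p: "p \<in> sphere 0 1" and F: "F \<in> Kkc_bdd B" for p F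
  proof (rule antisym)
    have bdd: "bdd_below ((\<lambda>q. support_fun q F + B * dist p q) ` D)"
      using lower[OF F] by (intro bdd_belowI2)
    show "support_fun p F \<le> h (p, F)"
      unfolding h_def using \<open>D \<noteq> {}\<close> lower[OF F] by (auto intro: cINF_greatest)
    show "h (p, F) \<le> support_fun p F"
    proof (rule field_le_epsilon)
      fix \<epsilon> :: real assume "0 < \<epsilon>"
      then have "0 < \<epsilon> / (2 * B)"
        using B by simp
      then obtain q where q: "q \<in> D" "dist q p < \<epsilon> / (2 * B)"
        using p D(3) closure_approachable[of p D] by blast
      then have "B * dist p q < \<epsilon> / 2"
        using B by (simp add: field_simps dist_commute)
      moreover have "h (p, F) \<le> support_fun q F + B * dist p q"
        unfolding h_def using cINF_lower[OF bdd q(1)] by simp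
      moreover have "support_fun q F \<le> support_fun p F + B * dist p q"
        using lower[OF F, of q p] by (simp add: dist_commute)
      ultimately show "h (p, F) \<le> support_fun p F + \<epsilon>"
        by linarith
    qed
  qed
  have "h \<in> borel_measurable (sphere_measure \<Otimes>\<^sub>M Kkc_borel B)"
    unfolding h_def
  proof (rule borel_measurable_cINF_real[OF D(1)])
    fix q assume "q \<in> D"
    then have [measurable]: "support_fun q \<in> borel_measurable (Kkc_borel B)"
      using D(2) by (intro support_fun_measurable_Kkc_borel[OF B]) auto
    have [measurable]: "(\<lambda>p. dist p q) \<in> borel_measurable sphere_measure"
      by (intro borel_measurable_sphere_continuous continuous_intros)
    show "(\<lambda>z. support_fun q (snd z) + B * dist (fst z) q)
        \<in> borel_measurable (sphere_measure \<Otimes>\<^sub>M Kkc_borel B)"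
      by measurable
  qed
  then show ?thesis
    by (rule measurable_cong[THEN iffD1, rotated]) (auto simp: space_pair_measure eq)
qed

section \<open>Frechet means as means of support functions\<close>

lemma sphere_Fubini:
  fixes h :: "'a::euclidean_space \<Rightarrow> 'w \<Rightarrow> real"
  assumes M: "finite_measure M"
    and h: "(\<lambda>(p, \<omega>). h p \<omega>) \<in> borel_measurable (sphere_measure \<Otimes>\<^sub>M M)"
    and bound: "\<And>p \<omega>. p \<in> sphere 0 1 \<Longrightarrow> \<omega> \<in> space M \<Longrightarrow> \<bar>h p \<omega>\<bar> \<le> b"
  shows "(\<integral>\<omega>. \<integral>p. h p \<omega> \<partial>sphere_measure \<partial>M) = (\<integral>p. \<integral>\<omega>. h p \<omega> \<partial>M \<partial>sphere_measure)"
    and "integrable M (\<lambda>\<omega>. \<integral>p. h p \<omega> \<partial>sphere_measure)"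
    and "integrable sphere_measure (\<lambda>p. \<integral>\<omega>. h p \<omega> \<partial>M)"
proof -
  interpret M: finite_measure M by (rule M)
  interpret pair_sigma_finite "sphere_measure :: 'a measure" M ..
  interpret P: finite_measure "(sphere_measure :: 'a measure) \<Otimes>\<^sub>M M"
    by (intro finite_measure_pair_measure M finite_measure_sphere_measure)
  have int: "integrable (sphere_measure \<Otimes>\<^sub>M M) (\<lambda>(p, \<omega>). h p \<omega>)"
    using h bound by (intro P.integrable_const_bound[of _ b]) (auto intro!: AE_I2 simp: space_pair_measure)
  show "(\<integral>\<omega>. \<integral>p. h p \<omega> \<partial>sphere_measure \<partial>M) = (\<integral>p. \<integral>\<omega>. h p \<omega> \<partial>M \<partial>sphere_measure)"
    by (rule Fubini_integral[OF int])
  show "integrable M (\<lambda>\<omega>. \<integral>p. h p \<omega> \<partial>sphere_measure)"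
    using integrable_snd[OF int] by simp
  show "integrable sphere_measure (\<lambda>p. \<integral>\<omega>. h p \<omega> \<partial>M)"
    using integrable_fst[OF int] by simp
qed

lemma support_fun_random_set_measurable_pair:
  fixes F :: "'w \<Rightarrow> 'a::euclidean_space set"
  assumes B: "0 < B" and F: "F \<in> M \<rightarrow>\<^sub>M Kkc_borel B"
  shows "(\<lambda>(p, \<omega>). support_fun p (F \<omega>)) \<in> borel_measurable (sphere_measure \<Otimes>\<^sub>M M)"
proof -
  have "(\<lambda>z. (fst z, F (snd z))) \<in> sphere_measure \<Otimes>\<^sub>M M \<rightarrow>\<^sub>M sphere_measure \<Otimes>\<^sub>M Kkc_borel B"
    using F by measurable
  from measurable_compose[OF this support_fun_measurable_pair[OF B]] show ?thesis
    by (simp add: split_def)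
qed

lemma support_fun_random_set_measurable:
  fixes F :: "'w \<Rightarrow> 'a::euclidean_space set"
  assumes B: "0 < B" and F: "F \<in> M \<rightarrow>\<^sub>M Kkc_borel B"
  shows "(\<lambda>\<omega>. support_fun p (F \<omega>)) \<in> borel_measurable M"
proof (cases "p = 0")
  case True
  have "support_fun p (F \<omega>) = 0" if "\<omega> \<in> space M" for \<omega>
    using support_fun_abs_le[of "F \<omega>" B p] measurable_space[OF F that] True by simp
  then show ?thesis
    by (subst measurable_cong[where g = "\<lambda>_. 0"]) auto
next
  case False
  have "support_fun p (F \<omega>) = norm p * support_fun (sgn p) (F \<omega>)" if "\<omega> \<in> space M" for \<omega>
    using support_fun_scaleR[of "F \<omega>" "norm p" "sgn p"] measurable_space[OF F that] False
    by (auto simp: sgn_div_norm dest: Kkc_bddD)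
  moreover have "(\<lambda>\<omega>. support_fun (sgn p) (F \<omega>)) \<in> borel_measurable M"
    using False by (intro measurable_compose[OF F] support_fun_measurable_Kkc_borel[OF B]) (simp add: norm_sgn)
  ultimately show ?thesis
    by (subst measurable_cong[where g = "\<lambda>\<omega>. norm p * support_fun (sgn p) (F \<omega>)"]) auto
qed

lemma arg_min_on_unique:
  fixes f :: "'b \<Rightarrow> real"
  assumes "x \<in> A" "\<And>y. y \<in> A \<Longrightarrow> y \<noteq> x \<Longrightarrow> f x < f y"
  shows "arg_min_on f A = x"
  unfolding arg_min_on_def arg_min_def
proof (rule some_equality)
  show "is_arg_min f (\<lambda>x. x \<in> A) x"
    using assms by (auto simp: is_arg_min_def) (metis less_asym)
  show "y = x" if "is_arg_min f (\<lambda>x. x \<in> A) y" for y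
    using that assms by (auto simp: is_arg_min_def)
qed

text \<open>Expectation preserves sublinearity, so the expected support function is again
  a support function; the set it describes is the Aumann expectation.\<close>

lemma expected_support_fun:
  fixes F :: "'w \<Rightarrow> 'a::euclidean_space set"
  assumes M: "prob_space M" and B: "0 < B" and F: "F \<in> M \<rightarrow>\<^sub>M Kkc_borel B"
  obtains G where "G \<in> Kkc_bdd B" "\<And>p. support_fun p G = (\<integral>\<omega>. support_fun p (F \<omega>) \<partial>M)"
proof (rule sublinear_is_support_fun)
  interpret prob_space M by (rule M)
  have FB: "F \<omega> \<in> Kkc_bdd B" if "\<omega> \<in> space M" for \<omega>
    using measurable_space[OF F that] by simp
  have int: "integrable M (\<lambda>\<omega>. support_fun p (F \<omega>))" for p
    using support_fun_random_set_measurable[OF B F] FB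
    by (intro integrable_const_bound[of _ "B * norm p"]) (auto intro!: AE_I2 support_fun_abs_le)
  show "(\<integral>\<omega>. support_fun (p + q) (F \<omega>) \<partial>M)
      \<le> (\<integral>\<omega>. support_fun p (F \<omega>) \<partial>M) + (\<integral>\<omega>. support_fun q (F \<omega>) \<partial>M)" for p q
  proof -
    have "(\<integral>\<omega>. support_fun (p + q) (F \<omega>) \<partial>M)
        \<le> (\<integral>\<omega>. support_fun p (F \<omega>) + support_fun q (F \<omega>) \<partial>M)"
      using FB by (intro integral_mono Bochner_Integration.integrable_add int support_fun_add_le)
        (auto dest: Kkc_bddD)
    then show ?thesis
      using int by simp
  qed
  show "(\<integral>\<omega>. support_fun (c *\<^sub>R p) (F \<omega>) \<partial>M) = c * (\<integral>\<omega>. support_fun p (F \<omega>) \<partial>M)"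
    if "0 \<le> c" for c p
  proof -
    have "(\<integral>\<omega>. support_fun (c *\<^sub>R p) (F \<omega>) \<partial>M) = (\<integral>\<omega>. c * support_fun p (F \<omega>) \<partial>M)"
      using FB that by (intro Bochner_Integration.integral_cong) (auto intro: support_fun_scaleR Kkc_bddD)
    then show ?thesis by simp
  qed
  show "(\<integral>\<omega>. support_fun p (F \<omega>) \<partial>M) \<le> B * norm p" for p
    using int FB by (intro integral_le_const) (auto intro!: AE_I2 support_fun_le_norm)
  show "0 \<le> B" using B by simp
qed (use that in blast)

text \<open>Bias--variance decomposition: at each direction the second moment about a point splits into the
  squared distance to the mean and a variance that does not involve the point.\<close>

lemma frechet_mean_eq_expectation:
  fixes F :: "'w \<Rightarrow> 'a::euclidean_space set"
  assumes M: "prob_space M" and B: "0 < B" and F: "F \<in> M \<rightarrow>\<^sub>M Kkc_borel B"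
    and G: "G \<in> Kkc_bdd B"
    and mean: "\<And>p. norm p = 1 \<Longrightarrow> support_fun p G = (\<integral>\<omega>. support_fun p (F \<omega>) \<partial>M)"
  shows "frechet_mean M B F = G"
proof -
  interpret prob_space M by (rule M)
  have FB: "F \<omega> \<in> Kkc_bdd B" if "\<omega> \<in> space M" for \<omega>
    using measurable_space[OF F that] by simp
  note meas [measurable] = support_fun_random_set_measurable_pair[OF B F]
    support_fun_random_set_measurable[OF B F]
  have decomp: "(\<integral>\<omega>. (d_kc H (F \<omega>))\<^sup>2 \<partial>M)
      = (d_kc H G)\<^sup>2 + (\<integral>p. \<integral>\<omega>. (support_fun p G - support_fun p (F \<omega>))\<^sup>2 \<partial>M \<partial>sphere_measure)"
    if H: "H \<in> Kkc_bdd B" for H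
  proof -
    have pair: "(\<lambda>(p, \<omega>). (support_fun p K - support_fun p (F \<omega>))\<^sup>2)
        \<in> borel_measurable (sphere_measure \<Otimes>\<^sub>M M)" if "K \<in> Kkc_bdd B" for K
      using support_fun_measurable_sphere[OF that] by measurable
    have bound: "\<bar>(support_fun p K - support_fun p (F \<omega>))\<^sup>2\<bar> \<le> (2 * B)\<^sup>2"
      if "K \<in> Kkc_bdd B" "p \<in> sphere 0 1" "\<omega> \<in> space M" for K p \<omega>
      using that FB by (intro abs_diff_power2_le support_fun_abs_le_sphere) auto
    have swap: "(\<integral>\<omega>. (d_kc K (F \<omega>))\<^sup>2 \<partial>M)
        = (\<integral>p. \<integral>\<omega>. (support_fun p K - support_fun p (F \<omega>))\<^sup>2 \<partial>M \<partial>sphere_measure)"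
      if "K \<in> Kkc_bdd B" for K
      unfolding d_kc_power2
      by (rule sphere_Fubini(1)[OF finite_measure_axioms pair[OF that]]) (rule bound[OF that])
    have var_int: "integrable sphere_measure (\<lambda>p. \<integral>\<omega>. (support_fun p G - support_fun p (F \<omega>))\<^sup>2 \<partial>M)"
      by (rule sphere_Fubini(3)[OF finite_measure_axioms pair[OF G]]) (rule bound[OF G])
    have pointwise: "(\<integral>\<omega>. (support_fun p H - support_fun p (F \<omega>))\<^sup>2 \<partial>M)
        = (support_fun p H - support_fun p G)\<^sup>2 + (\<integral>\<omega>. (support_fun p G - support_fun p (F \<omega>))\<^sup>2 \<partial>M)"
      if p: "p \<in> sphere 0 1" for p
    proof -
      let ?h = "support_fun p H" and ?g = "support_fun p G"
      have int1: "integrable M (\<lambda>\<omega>. support_fun p (F \<omega>))"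
        using FB p by (intro integrable_const_bound[of _ B]) (auto intro!: AE_I2 support_fun_abs_le_sphere)
      have int2: "integrable M (\<lambda>\<omega>. (?g - support_fun p (F \<omega>))\<^sup>2)"
        using bound[OF G p] by (intro integrable_const_bound[of _ "(2 * B)\<^sup>2"]) auto
      have "(\<integral>\<omega>. (?h - support_fun p (F \<omega>))\<^sup>2 \<partial>M)
          = (\<integral>\<omega>. (?h - ?g)\<^sup>2 + 2 * (?h - ?g) * (?g - support_fun p (F \<omega>))
              + (?g - support_fun p (F \<omega>))\<^sup>2 \<partial>M)"
        by (intro Bochner_Integration.integral_cong) (auto simp: power2_eq_square algebra_simps)
      also have "\<dots> = (?h - ?g)\<^sup>2 + 2 * (?h - ?g) * (?g - (\<integral>\<omega>. support_fun p (F \<omega>) \<partial>M))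
          + (\<integral>\<omega>. (?g - support_fun p (F \<omega>))\<^sup>2 \<partial>M)"
        using int1 int2 by (simp add: prob_space)
      finally show ?thesis
        using mean[of p] p by simp
    qed
    have "(\<integral>\<omega>. (d_kc H (F \<omega>))\<^sup>2 \<partial>M)
        = (\<integral>p. (support_fun p H - support_fun p G)\<^sup>2
            + (\<integral>\<omega>. (support_fun p G - support_fun p (F \<omega>))\<^sup>2 \<partial>M) \<partial>sphere_measure)"
      unfolding swap[OF H]
      by (intro Bochner_Integration.integral_cong) (auto simp: pointwise)
    then show ?thesis
      unfolding d_kc_power2
      using integrable_support_fun_diff_power2[OF H G] var_int by simp
  qed
  show ?thesis
    unfolding frechet_mean_def
  proof (rule arg_min_on_unique[OF G])
    fix H assume H: "H \<in> Kkc_bdd B" and "H \<noteq> G"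
    then have "d_kc H G \<noteq> 0"
      by (simp add: d_kc_eq_0_iff[OF B H G])
    then show "(\<integral>\<omega>. (d_kc G (F \<omega>))\<^sup>2 \<partial>M) < (\<integral>\<omega>. (d_kc H (F \<omega>))\<^sup>2 \<partial>M)"
      by (simp add: decomp[OF H] decomp[OF G])
  qed
qed

lemma support_fun_weighted_minkowski_mean:
  fixes F :: "nat \<Rightarrow> 'a::euclidean_space set"
  assumes F: "\<And>i. i < n \<Longrightarrow> F i \<in> Kkc" and w: "\<And>i. i < n \<Longrightarrow> 0 \<le> w i"
  shows "weighted_minkowski_mean n w F \<in> Kkc"
    and "support_fun p (weighted_minkowski_mean n w F)
      = (\<Sum>i<n. w i * support_fun p (F i)) / (\<Sum>i<n. w i)"
proof -
  have K: "set_scale (w i) (F i) \<in> Kkc" if "i < n" for i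
    using F[OF that] by (rule Kkc_set_scale)
  have K_sum: "(\<Sum>i<n. set_scale (w i) (F i)) \<in> Kkc"
    using K by (intro Kkc_sum) auto
  then show "weighted_minkowski_mean n w F \<in> Kkc"
    by (simp add: weighted_minkowski_mean_def Kkc_set_scale)
  have "support_fun p (\<Sum>i<n. set_scale (w i) (F i)) = (\<Sum>i<n. support_fun p (set_scale (w i) (F i)))"
    using K by (intro support_fun_sum) auto
  also have "\<dots> = (\<Sum>i<n. w i * support_fun p (F i))"
    using w F by (intro sum.cong) (auto intro: support_fun_set_scale)
  finally have sum: "support_fun p (\<Sum>i<n. set_scale (w i) (F i)) = (\<Sum>i<n. w i * support_fun p (F i))" .
  have nonneg: "0 \<le> inverse (1 / real n * (\<Sum>i<n. w i))" "0 \<le> 1 / real n"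
    using w by (auto intro!: divide_nonneg_nonneg sum_nonneg)
  have "support_fun p (weighted_minkowski_mean n w F)
      = inverse (1 / real n * (\<Sum>i<n. w i)) * (1 / real n * (\<Sum>i<n. w i * support_fun p (F i)))"
    unfolding weighted_minkowski_mean_def support_fun_set_scale[OF Kkc_set_scale[OF K_sum] nonneg(1)]
      support_fun_set_scale[OF K_sum nonneg(2)] sum ..
  then show "support_fun p (weighted_minkowski_mean n w F)
      = (\<Sum>i<n. w i * support_fun p (F i)) / (\<Sum>i<n. w i)"
    by (cases "n = 0") (auto simp: field_simps)
qed

lemma weighted_minkowski_mean_in_Kkc_bdd:
  fixes F :: "nat \<Rightarrow> 'a::euclidean_space set"
  assumes B: "0 < B" and F: "\<And>i. i < n \<Longrightarrow> F i \<in> Kkc_bdd B"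
    and w: "\<And>i. i < n \<Longrightarrow> 0 \<le> w i" and W: "0 < (\<Sum>i<n. w i)"
  shows "weighted_minkowski_mean n w F \<in> Kkc_bdd B"
proof (rule Kkc_bdd_if_support_fun_le)
  show "weighted_minkowski_mean n w F \<in> Kkc"
    using F w by (intro support_fun_weighted_minkowski_mean) (auto dest: Kkc_bddD)
  fix p :: 'a assume p: "norm p = 1"
  have "(\<Sum>i<n. w i * support_fun p (F i)) \<le> (\<Sum>i<n. w i * B)"
    using F w p support_fun_le_norm[of _ B p] by (intro sum_mono mult_left_mono) auto
  then show "support_fun p (weighted_minkowski_mean n w F) \<le> B"
    using F w W
    by (subst support_fun_weighted_minkowski_mean)
       (auto dest: Kkc_bddD simp: divide_le_eq sum_distrib_left mult.commute)
qed (use B in simp)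

lemma weighted_frechet_mean_eq_minkowski_mean:
  fixes F :: "nat \<Rightarrow> 'a::euclidean_space set"
  assumes B: "0 < B" and F: "\<And>i. i < n \<Longrightarrow> F i \<in> Kkc_bdd B"
    and w: "\<And>i. i < n \<Longrightarrow> 0 \<le> w i" and W: "0 < (\<Sum>i<n. w i)"
  shows "arg_min_on (\<lambda>\<nu>. 1 / real n * (\<Sum>i<n. w i * (d_kc \<nu> (F i))\<^sup>2)) (Kkc_bdd B)
      = weighted_minkowski_mean n w F"
proof -
  let ?G = "weighted_minkowski_mean n w F" and ?W = "\<Sum>i<n. w i"
  have G: "?G \<in> Kkc_bdd B"
    using assms by (rule weighted_minkowski_mean_in_Kkc_bdd)
  have n: "0 < n"
    using W by (cases n) auto
  have decomp: "(\<Sum>i<n. w i * (d_kc H (F i))\<^sup>2) = ?W * (d_kc H ?G)\<^sup>2 + (\<Sum>i<n. w i * (d_kc ?G (F i))\<^sup>2)"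
    if H: "H \<in> Kkc_bdd B" for H
  proof -
    have pointwise: "(\<Sum>i<n. w i * (x - s i)\<^sup>2) = ?W * (x - g)\<^sup>2 + (\<Sum>i<n. w i * (g - s i)\<^sup>2)"
      if g: "g = (\<Sum>i<n. w i * s i) / ?W" for s :: "nat \<Rightarrow> real" and x g
    proof -
      have "(\<Sum>i<n. w i * (x - s i)\<^sup>2)
          = (\<Sum>i<n. w i * (x - g)\<^sup>2 + 2 * (x - g) * (g * w i - w i * s i) + w i * (g - s i)\<^sup>2)"
        by (intro sum.cong) (auto simp: power2_eq_square algebra_simps)
      also have "\<dots> = ?W * (x - g)\<^sup>2 + 2 * (x - g) * (g * ?W - (\<Sum>i<n. w i * s i))
          + (\<Sum>i<n. w i * (g - s i)\<^sup>2)"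
        by (simp only: sum.distrib sum_distrib_left[symmetric] sum_distrib_right[symmetric] sum_subtractf)
      finally show ?thesis
        using W g by simp
    qed
    have int: "integrable sphere_measure (\<lambda>p. (support_fun p H - support_fun p (F i))\<^sup>2)"
      "integrable sphere_measure (\<lambda>p. (support_fun p ?G - support_fun p (F i))\<^sup>2)" if "i < n" for i
      using F[OF that] G H by (auto intro: integrable_support_fun_diff_power2)
    have "(\<Sum>i<n. w i * (d_kc H (F i))\<^sup>2)
        = (\<integral>p. (\<Sum>i<n. w i * (support_fun p H - support_fun p (F i))\<^sup>2) \<partial>sphere_measure)"
      using int(1) by (subst Bochner_Integration.integral_sum) (auto simp: d_kc_power2)
    also have "\<dots> = (\<integral>p. ?W * (support_fun p H - support_fun p ?G)\<^sup>2
        + (\<Sum>i<n. w i * (support_fun p ?G - support_fun p (F i))\<^sup>2) \<partial>sphere_measure)"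
      using F w
      by (intro Bochner_Integration.integral_cong refl pointwise support_fun_weighted_minkowski_mean)
         (auto dest: Kkc_bddD)
    also have "\<dots> = ?W * (d_kc H ?G)\<^sup>2 + (\<Sum>i<n. w i * (d_kc ?G (F i))\<^sup>2)"
      using int(2) integrable_support_fun_diff_power2[OF H G]
      by (subst Bochner_Integration.integral_add)
         (auto intro!: Bochner_Integration.integrable_sum simp: Bochner_Integration.integral_sum d_kc_power2)
    finally show ?thesis .
  qed
  show ?thesis
  proof (rule arg_min_on_unique[OF G])
    fix H assume H: "H \<in> Kkc_bdd B" and "H \<noteq> ?G"
    then have "0 < (d_kc H ?G)\<^sup>2"
      by (simp add: d_kc_eq_0_iff[OF B H G])
    then have "(\<Sum>i<n. w i * (d_kc ?G (F i))\<^sup>2) < (\<Sum>i<n. w i * (d_kc H (F i))\<^sup>2)"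
      using W by (simp add: decomp[OF H])
    then show "1 / real n * (\<Sum>i<n. w i * (d_kc ?G (F i))\<^sup>2) < 1 / real n * (\<Sum>i<n. w i * (d_kc H (F i))\<^sup>2)"
      using n by (simp add: divide_strict_right_mono)
  qed
qed

section \<open>Perturbation of the weights\<close>

text \<open>Deterministic core of the rate: the weights \<open>w\<close> with estimated propensities are compared with
  the weights \<open>a\<close> with true ones.  The average weight stays at least \<open>1 / 4\<close>, and what remains is the
  fluctuation of the average with the true weights plus a bias of the order of the weight error.\<close>

lemma weighted_minkowski_mean_perturbation:
  fixes F :: "nat \<Rightarrow> 'a::euclidean_space set" and w a :: "nat \<Rightarrow> real"
  assumes B: "0 < B" and F: "\<And>i. i < n \<Longrightarrow> F i \<in> Kkc_bdd B" and G: "G \<in> Kkc_bdd B"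
    and w: "\<And>i. i < n \<Longrightarrow> 0 \<le> w i" and wa: "\<And>i. i < n \<Longrightarrow> \<bar>w i - a i\<bar> \<le> \<kappa>"
    and \<kappa>: "0 \<le> \<kappa>" "\<kappa> \<le> 1 / 4" and n: "0 < n" and a: "1 / 2 \<le> (\<Sum>i<n. a i) / real n"
  shows "0 < (\<Sum>i<n. w i)"
    and "d_kc (weighted_minkowski_mean n w F) G
      \<le> 4 * (sqrt (\<integral>p. ((\<Sum>i<n. a i * (support_fun p (F i) - support_fun p G)) / real n)\<^sup>2 \<partial>sphere_measure)
           + \<kappa> * (2 * B) * sqrt (measure sphere_measure (sphere 0 1 :: 'a set)))"
proof -
  define W where "W = (\<Sum>i<n. w i) / real n"
  have sum_wa: "(\<Sum>i<n. \<bar>w i - a i\<bar>) \<le> real n * \<kappa>"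
    using sum_mono[of "{..<n}" "\<lambda>i. \<bar>w i - a i\<bar>" "\<lambda>_. \<kappa>"] wa by simp
  have "(\<Sum>i<n. a i) - (\<Sum>i<n. w i) \<le> (\<Sum>i<n. \<bar>w i - a i\<bar>)"
    unfolding sum_subtractf[symmetric] by (intro sum_mono) auto
  with sum_wa have "(\<Sum>i<n. a i) / real n - W \<le> \<kappa>"
    using n by (simp add: W_def diff_divide_distrib[symmetric] divide_le_eq mult.commute)
  then have W: "1 / 4 \<le> W"
    using a \<kappa> by linarith
  show W_pos: "0 < (\<Sum>i<n. w i)"
    using W n by (simp add: W_def field_simps)
  define f where "f p = (\<Sum>i<n. a i * (support_fun p (F i) - support_fun p G)) / real n" for p
  define g where "g p = (\<Sum>i<n. (w i - a i) * (support_fun p (F i) - support_fun p G)) / real n" for p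
  have diff_le: "\<bar>support_fun p (F i) - support_fun p G\<bar> \<le> 2 * B" if "i < n" "p \<in> sphere 0 1" for i p
    using support_fun_abs_le_sphere[OF F[OF that(1)] that(2)] support_fun_abs_le_sphere[OF G that(2)]
    by linarith
  have split: "support_fun p (weighted_minkowski_mean n w F) - support_fun p G = 1 / W * (f p + g p)" for p
  proof -
    have "f p + g p = (\<Sum>i<n. w i * (support_fun p (F i) - support_fun p G)) / real n"
      by (simp add: f_def g_def add_divide_distrib[symmetric] sum.distrib[symmetric] algebra_simps)
    also have "\<dots> = ((\<Sum>i<n. w i * support_fun p (F i)) - (\<Sum>i<n. w i) * support_fun p G) / real n"
      by (simp add: right_diff_distrib sum_subtractf sum_distrib_right)
    finally have fg: "f p + g p = \<dots>" .
    have "support_fun p (weighted_minkowski_mean n w F) = (\<Sum>i<n. w i * support_fun p (F i)) / (\<Sum>i<n. w i)"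
      using F w by (intro support_fun_weighted_minkowski_mean) (auto dest: Kkc_bddD)
    then show ?thesis
      using W_pos n by (simp add: fg W_def field_simps)
  qed
  have g_le: "\<bar>g p\<bar> \<le> \<kappa> * (2 * B)" if "p \<in> sphere 0 1" for p
  proof -
    have "\<bar>\<Sum>i<n. (w i - a i) * (support_fun p (F i) - support_fun p G)\<bar>
        \<le> (\<Sum>i<n. \<bar>w i - a i\<bar> * \<bar>support_fun p (F i) - support_fun p G\<bar>)"
      by (rule order_trans[OF sum_abs]) (simp add: abs_mult)
    also have "\<dots> \<le> (\<Sum>i<n. \<kappa> * (2 * B))"
      using wa diff_le that \<kappa> by (intro sum_mono mult_mono) auto
    finally show ?thesis
      using n by (simp add: g_def divide_le_eq mult.commute)
  qed
  have f_meas: "f \<in> borel_measurable sphere_measure" and g_meas: "g \<in> borel_measurable sphere_measure"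
    unfolding f_def g_def
    using support_fun_measurable_sphere[OF G] support_fun_measurable_sphere[OF F] by measurable
  have g_power2: "(g p)\<^sup>2 \<le> (\<kappa> * (2 * B))\<^sup>2" if "p \<in> sphere 0 1" for p
    using g_le[OF that] \<kappa> B by (subst abs_le_square_iff[symmetric]) (simp add: abs_mult)
  have f_int: "integrable sphere_measure (\<lambda>p. (f p)\<^sup>2)"
  proof (rule integrable_sphere_bounded)
    fix p :: 'a assume p: "p \<in> sphere 0 1"
    have "\<bar>\<Sum>i<n. a i * (support_fun p (F i) - support_fun p G)\<bar> \<le> (\<Sum>i<n. \<bar>a i\<bar> * (2 * B))"
      using diff_le p by (intro order_trans[OF sum_abs] sum_mono) (auto simp: abs_mult intro!: mult_left_mono)
    then have "\<bar>f p\<bar> \<le> (\<Sum>i<n. \<bar>a i\<bar> * (2 * B)) / real n"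
      using n by (simp add: f_def divide_right_mono)
    then show "\<bar>(f p)\<^sup>2\<bar> \<le> ((\<Sum>i<n. \<bar>a i\<bar> * (2 * B)) / real n)\<^sup>2"
      by (simp only: abs_power2) (metis abs_le_square_iff abs_of_nonneg abs_ge_zero order_trans)
  qed (use f_meas in measurable)
  have g_int: "integrable sphere_measure (\<lambda>p. (g p)\<^sup>2)"
    using g_meas g_power2 by (intro integrable_sphere_bounded[of _ "(\<kappa> * (2 * B))\<^sup>2"]) auto
  have "d_kc (weighted_minkowski_mean n w F) G = sqrt (\<integral>p. (1 / W)\<^sup>2 * (f p + g p)\<^sup>2 \<partial>sphere_measure)"
    by (simp only: d_kc_def split power_mult_distrib)
  also have "\<dots> = 1 / W * sqrt (\<integral>p. (f p + g p)\<^sup>2 \<partial>sphere_measure)"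
    using W by (simp add: real_sqrt_mult)
  also have "\<dots> \<le> 4 * (sqrt (\<integral>p. (f p)\<^sup>2 \<partial>sphere_measure) + sqrt (\<integral>p. (g p)\<^sup>2 \<partial>sphere_measure))"
    using W by (intro mult_mono L2_triangle f_int g_int) (auto simp: field_simps)
  also have "sqrt (\<integral>p. (g p)\<^sup>2 \<partial>sphere_measure)
      \<le> sqrt (\<integral>p. (\<kappa> * (2 * B))\<^sup>2 \<partial>(sphere_measure :: 'a measure))"
    using g_power2 g_int by (intro real_sqrt_le_mono integral_mono) auto
  also have "\<dots> = \<kappa> * (2 * B) * sqrt (measure sphere_measure (sphere 0 1 :: 'a set))"
    using \<kappa> B by (simp add: real_sqrt_mult)
  finally show "d_kc (weighted_minkowski_mean n w F) G
      \<le> 4 * (sqrt (\<integral>p. ((\<Sum>i<n. a i * (support_fun p (F i) - support_fun p G)) / real n)\<^sup>2 \<partial>sphere_measure)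
           + \<kappa> * (2 * B) * sqrt (measure sphere_measure (sphere 0 1 :: 'a set)))"
    by (simp add: f_def)
qed

section \<open>Inverse probability weighting\<close>

lemma (in prob_space) mean_square_average_orthogonal:
  fixes Y :: "nat \<Rightarrow> 'a \<Rightarrow> real"
  assumes meas: "\<And>i. Y i \<in> borel_measurable M"
    and bound: "\<And>i \<omega>. \<omega> \<in> space M \<Longrightarrow> \<bar>Y i \<omega>\<bar> \<le> K"
    and orth: "\<And>i j. i \<noteq> j \<Longrightarrow> (\<integral>\<omega>. Y i \<omega> * Y j \<omega> \<partial>M) = 0"
  shows "(\<integral>\<omega>. ((\<Sum>i<n. Y i \<omega>) / real n)\<^sup>2 \<partial>M) \<le> K\<^sup>2 / real n"
proof -
  have bound_mult: "\<bar>Y i \<omega> * Y j \<omega>\<bar> \<le> K\<^sup>2" if "\<omega> \<in> space M" for i j \<omega>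
    unfolding abs_mult power2_eq_square
    by (intro mult_mono' bound that abs_ge_zero)
  have int: "integrable M (\<lambda>\<omega>. Y i \<omega> * Y j \<omega>)" for i j
    using bound_mult meas by (intro integrable_const_bound[of _ "K\<^sup>2"]) (auto intro!: AE_I2)
  have "(\<integral>\<omega>. (\<Sum>i<n. Y i \<omega>)\<^sup>2 \<partial>M) = (\<Sum>i<n. \<Sum>j<n. \<integral>\<omega>. Y i \<omega> * Y j \<omega> \<partial>M)"
    using int by (simp add: power2_eq_square sum_product Bochner_Integration.integral_sum
      Bochner_Integration.integrable_sum)
  also have "\<dots> = (\<Sum>i<n. \<integral>\<omega>. Y i \<omega> * Y i \<omega> \<partial>M)"
  proof (intro sum.cong refl)
    fix i assume "i \<in> {..<n}"
    have "(\<Sum>j<n. \<integral>\<omega>. Y i \<omega> * Y j \<omega> \<partial>M) = (\<Sum>j<n. if j = i then \<integral>\<omega>. Y i \<omega> * Y i \<omega> \<partial>M else 0)"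
      using orth by (intro sum.cong) auto
    then show "(\<Sum>j<n. \<integral>\<omega>. Y i \<omega> * Y j \<omega> \<partial>M) = (\<integral>\<omega>. Y i \<omega> * Y i \<omega> \<partial>M)"
      using \<open>i \<in> {..<n}\<close> by simp
  qed
  also have "\<dots> \<le> (\<Sum>i<n. K\<^sup>2)"
  proof (rule sum_mono)
    fix i
    show "(\<integral>\<omega>. Y i \<omega> * Y i \<omega> \<partial>M) \<le> K\<^sup>2"
      using bound_mult[of _ i i] by (intro integral_le_const int AE_I2) (metis abs_le_D1)
  qed
  finally have "(\<integral>\<omega>. (\<Sum>i<n. Y i \<omega>)\<^sup>2 \<partial>M) \<le> real n * K\<^sup>2"
    by simp
  then have "(\<integral>\<omega>. (\<Sum>i<n. Y i \<omega>)\<^sup>2 \<partial>M) / (real n)\<^sup>2 \<le> real n * K\<^sup>2 / (real n)\<^sup>2"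
    by (rule divide_right_mono) simp
  then show ?thesis
    by (cases "n = 0") (simp_all add: power_divide power2_eq_square)
qed

locale ipw_sample = prob_space M for M :: "'w measure" +
  fixes B \<eta> :: real and S :: "'x::euclidean_space set"
    and F :: "'w \<Rightarrow> 'a::euclidean_space set" and X :: "'w \<Rightarrow> 'x" and T :: "'w \<Rightarrow> real"
    and Fs :: "nat \<Rightarrow> 'w \<Rightarrow> 'a set" and Xs :: "nat \<Rightarrow> 'w \<Rightarrow> 'x" and Ts :: "nat \<Rightarrow> 'w \<Rightarrow> real"
    and e :: "'x \<Rightarrow> real"
  assumes B: "0 < B" and \<eta>: "0 < \<eta>"
    and FXT: "(\<lambda>\<omega>. (F \<omega>, X \<omega>, T \<omega>)) \<in> M \<rightarrow>\<^sub>M obs_space B S"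
    and mar: "cond_indep_given M (sigma_gen_by M X) (Kkc_borel B) F (count_space {0, 1}) T"
    and indep: "indep_vars (\<lambda>_. obs_space B S) (\<lambda>i \<omega>. (Fs i \<omega>, Xs i \<omega>, Ts i \<omega>)) UNIV"
    and ident: "\<And>i. distr M (obs_space B S) (\<lambda>\<omega>. (Fs i \<omega>, Xs i \<omega>, Ts i \<omega>))
      = distr M (obs_space B S) (\<lambda>\<omega>. (F \<omega>, X \<omega>, T \<omega>))"
    and propensity: "is_propensity M S X T e"
    and overlap: "\<And>x. x \<in> S \<Longrightarrow> \<eta> \<le> e x"
begin

lemma e_measurable [measurable]: "e \<in> borel_measurable (restrict_space borel S)"
  using propensity by (simp add: is_propensity_def)

lemma space_obs_space: "space (obs_space B S) = Kkc_bdd B \<times> S \<times> {0, 1}"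
  by (simp add: obs_space_def space_pair_measure space_restrict_space)

lemma sample_measurable: "(\<lambda>\<omega>. (Fs i \<omega>, Xs i \<omega>, Ts i \<omega>)) \<in> M \<rightarrow>\<^sub>M obs_space B S"
  using indep by (auto simp: indep_vars_def2)

lemma random_set_measurable: "F \<in> M \<rightarrow>\<^sub>M Kkc_borel B"
  using measurable_compose[OF FXT[unfolded obs_space_def] measurable_fst] by simp

lemma covariate_measurable: "X \<in> M \<rightarrow>\<^sub>M restrict_space borel S"
  using measurable_compose[OF measurable_compose[OF FXT[unfolded obs_space_def] measurable_snd] measurable_fst]
  by simp

lemma treatment_measurable: "T \<in> M \<rightarrow>\<^sub>M count_space {0, 1}"
  using measurable_compose[OF measurable_compose[OF FXT[unfolded obs_space_def] measurable_snd] measurable_snd]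
  by simp

lemma sample_set_measurable: "Fs i \<in> M \<rightarrow>\<^sub>M Kkc_borel B"
  using measurable_compose[OF sample_measurable[unfolded obs_space_def] measurable_fst] by simp

lemma observation_in:
  assumes "\<omega> \<in> space M"
  shows "F \<omega> \<in> Kkc_bdd B" "X \<omega> \<in> S" "T \<omega> \<in> {0, 1}"
  using measurable_space[OF FXT assms] by (auto simp: space_obs_space)

lemma sample_in:
  assumes "\<omega> \<in> space M"
  shows "Fs i \<omega> \<in> Kkc_bdd B" "Xs i \<omega> \<in> S" "Ts i \<omega> \<in> {0, 1}"
  using measurable_space[OF sample_measurable assms] by (auto simp: space_obs_space)

lemma weight_bounds:
  assumes "x \<in> S" "t \<in> {0, 1 :: real}"
  shows "0 \<le> t / e x" "t / e x \<le> 1 / \<eta>"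
  using overlap[OF assms(1)] \<eta> assms(2) by (auto intro: frac_le)

lemma weighted_measurable:
  assumes h: "h \<in> borel_measurable (Kkc_borel B)"
  shows "(\<lambda>(K, x, t). t / e x * h K) \<in> borel_measurable (obs_space B S)"
proof -
  have [measurable]: "(\<lambda>t. t) \<in> borel_measurable (count_space {0, 1 :: real})"
    by simp
  have "(\<lambda>z. snd (snd z) / e (fst (snd z)) * h (fst z)) \<in> borel_measurable (obs_space B S)"
    unfolding obs_space_def using h by measurable
  then show ?thesis
    by (simp add: split_def)
qed

lemma sample_expectation:
  fixes g :: "'a set \<times> 'x \<times> real \<Rightarrow> real"
  assumes "g \<in> borel_measurable (obs_space B S)"
  shows "(\<integral>\<omega>. g (Fs i \<omega>, Xs i \<omega>, Ts i \<omega>) \<partial>M) = (\<integral>\<omega>. g (F \<omega>, X \<omega>, T \<omega>) \<partial>M)"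
  using integral_distr[OF sample_measurable assms, of i] integral_distr[OF FXT assms] ident[of i]
  by simp

text \<open>The weight cancels the probability of being observed: conditionally on the covariate the
  indicator of an event for the set and the treatment are independent, so the inner expectation of
  the weight is \<open>e X / e X\<close>.\<close>

lemma weighted_probability:
  assumes A: "A \<in> sets (Kkc_borel B)"
  shows "(\<integral>\<omega>. T \<omega> / e (X \<omega>) * indicator A (F \<omega>) \<partial>M) = (\<integral>\<omega>. indicator A (F \<omega>) \<partial>M)"
proof -
  note [measurable] = random_set_measurable covariate_measurable treatment_measurable
  let ?G = "sigma_gen_by M X"
  have X_borel: "X \<in> borel_measurable M"
    using covariate_measurable by (simp add: measurable_restrict_space2_iff)
  have subalg: "subalgebra M ?G"
    unfolding subalgebra_def
  proof
    show "sets ?G \<subseteq> sets M"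
      using measurable_sets[OF X_borel] by (auto simp: sigma_gen_by_def sets_vimage_algebra2)
  qed (simp add: sigma_gen_by_def)
  interpret G: finite_measure_subalgebra M ?G
    by unfold_locales (rule subalg)
  have "X \<in> ?G \<rightarrow>\<^sub>M restrict_space borel S"
    unfolding sigma_gen_by_def
    using observation_in(2) by (intro measurable_restrict_space2 measurable_vimage_algebra1) auto
  then have inv_meas: "(\<lambda>\<omega>. 1 / e (X \<omega>)) \<in> borel_measurable ?G"
    by measurable
  have inv_meas' [measurable]: "(\<lambda>\<omega>. 1 / e (X \<omega>)) \<in> borel_measurable M"
    by measurable
  have inv_bound: "\<bar>1 / e (X \<omega>)\<bar> \<le> 1 / \<eta>" if "\<omega> \<in> space M" for \<omega>
    using weight_bounds[of "X \<omega>" 1] observation_in[OF that] by simp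
  let ?A = "\<lambda>\<omega>. indicator A (F \<omega>) :: real" and ?T = "\<lambda>\<omega>. indicator {1} (T \<omega>) :: real"
  have A_meas [measurable]: "?A \<in> borel_measurable M"
    using A by measurable
  have T_meas [measurable]: "?T \<in> borel_measurable M"
    by (rule measurable_compose[OF treatment_measurable]) simp
  have int: "integrable M (\<lambda>\<omega>. 1 / e (X \<omega>) * (?A \<omega> * ?T \<omega>))"
  proof (intro integrable_const_bound[of _ "1 / \<eta>"] AE_I2)
    show "norm (1 / e (X \<omega>) * (?A \<omega> * ?T \<omega>)) \<le> 1 / \<eta>" if "\<omega> \<in> space M" for \<omega>
      using inv_bound[OF that] \<eta> by (auto simp: indicator_def)
  qed (intro borel_measurable_times inv_meas' A_meas T_meas)
  have ci: "AE \<omega> in M. real_cond_exp M ?G (\<lambda>w. ?A w * ?T w) \<omega>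
      = real_cond_exp M ?G ?A \<omega> * real_cond_exp M ?G ?T \<omega>"
    using mar A unfolding cond_indep_given_def by auto
  have "AE \<omega> in M. real_cond_exp M ?G ?T \<omega> = e (X \<omega>)"
    using propensity by (simp add: is_propensity_def)
  with ci AE_space have cancel: "AE \<omega> in M. 1 / e (X \<omega>) * real_cond_exp M ?G (\<lambda>w. ?A w * ?T w) \<omega>
      = real_cond_exp M ?G ?A \<omega>"
  proof eventually_elim
    case (elim \<omega>)
    have "e (X \<omega>) \<noteq> 0"
      using overlap[OF observation_in(2)[OF elim(2)]] \<eta> by auto
    with elim(1,3) show ?case
      by simp
  qed
  have "(\<integral>\<omega>. T \<omega> / e (X \<omega>) * ?A \<omega> \<partial>M) = (\<integral>\<omega>. 1 / e (X \<omega>) * (?A \<omega> * ?T \<omega>) \<partial>M)"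
    using observation_in(3) by (intro Bochner_Integration.integral_cong) (auto simp: indicator_def)
  also have "\<dots> = (\<integral>\<omega>. 1 / e (X \<omega>) * real_cond_exp M ?G (\<lambda>w. ?A w * ?T w) \<omega> \<partial>M)"
    by (intro G.real_cond_exp_intg(2)[symmetric] int inv_meas) measurable
  also have "\<dots> = (\<integral>\<omega>. real_cond_exp M ?G ?A \<omega> \<partial>M)"
    using cancel by (intro integral_cong_AE) auto
  also have "\<dots> = (\<integral>\<omega>. ?A \<omega> \<partial>M)"
    by (intro G.real_cond_exp_int(2) integrable_const_bound[of _ 1] A_meas AE_I2)
       (auto simp: indicator_def)
  finally show ?thesis .
qed

text \<open>Hence the law of the set under the measure with density \<open>T / e X\<close> is its original law.\<close>

lemma weighted_expectation:
  fixes h :: "'a set \<Rightarrow> real"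
  assumes h: "h \<in> borel_measurable (Kkc_borel B)"
  shows "(\<integral>\<omega>. T \<omega> / e (X \<omega>) * h (F \<omega>) \<partial>M) = (\<integral>\<omega>. h (F \<omega>) \<partial>M)"
proof -
  note F_meas [measurable] = random_set_measurable
  have "(\<lambda>(K, x, t). t / e x * 1) \<in> borel_measurable (obs_space B S)"
    by (rule weighted_measurable) simp
  from measurable_compose[OF FXT this]
  have w_meas [measurable]: "(\<lambda>\<omega>. T \<omega> / e (X \<omega>)) \<in> borel_measurable M"
    by simp
  have w_bounds: "0 \<le> T \<omega> / e (X \<omega>)" "T \<omega> / e (X \<omega>) \<le> 1 / \<eta>" if "\<omega> \<in> space M" for \<omega>
    using weight_bounds[of "X \<omega>" "T \<omega>"] observation_in[OF that] by auto
  define N where "N = density M (\<lambda>\<omega>. ennreal (T \<omega> / e (X \<omega>)))"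
  have F_N [measurable]: "F \<in> N \<rightarrow>\<^sub>M Kkc_borel B"
    by (simp add: N_def F_meas)
  have "distr N (Kkc_borel B) F = distr M (Kkc_borel B) F"
  proof (rule measure_eqI)
    fix A assume "A \<in> sets (distr N (Kkc_borel B) F)"
    then have A [measurable]: "A \<in> sets (Kkc_borel B)" by simp
    have vim: "F -` A \<inter> space M \<in> sets M"
      by (rule measurable_sets[OF F_meas A])
    have "emeasure (distr N (Kkc_borel B) F) A = emeasure N (F -` A \<inter> space M)"
      using F_N A by (subst emeasure_distr) (auto simp: N_def)
    also have "\<dots> = (\<integral>\<^sup>+\<omega>. ennreal (T \<omega> / e (X \<omega>)) * indicator (F -` A \<inter> space M) \<omega> \<partial>M)"
      unfolding N_def using vim by (intro emeasure_density) measurable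
    also have "\<dots> = (\<integral>\<^sup>+\<omega>. ennreal (T \<omega> / e (X \<omega>) * indicator A (F \<omega>)) \<partial>M)"
      by (intro nn_integral_cong) (auto simp: indicator_def)
    also have "\<dots> = ennreal (\<integral>\<omega>. T \<omega> / e (X \<omega>) * indicator A (F \<omega>) \<partial>M)"
    proof (intro nn_integral_eq_integral integrable_const_bound[of _ "1 / \<eta>"] AE_I2)
      fix \<omega> assume "\<omega> \<in> space M"
      then show "norm (T \<omega> / e (X \<omega>) * indicator A (F \<omega>)) \<le> 1 / \<eta>"
        and "0 \<le> T \<omega> / e (X \<omega>) * indicator A (F \<omega>)"
        using w_bounds[of \<omega>] \<eta> by (auto simp: indicator_def abs_of_nonneg simp del: abs_divide)
    next
      have "(\<lambda>\<omega>. indicator A (F \<omega>) :: real) \<in> borel_measurable M"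
        using A by measurable
      with w_meas show "(\<lambda>\<omega>. T \<omega> / e (X \<omega>) * indicator A (F \<omega>)) \<in> borel_measurable M"
        by (rule borel_measurable_times)
    qed
    also have "\<dots> = ennreal (\<integral>\<omega>. indicator A (F \<omega>) \<partial>M)"
      by (simp only: weighted_probability[OF A])
    also have "(\<integral>\<omega>. indicator A (F \<omega>) \<partial>M) = (\<integral>\<omega>. indicator (F -` A \<inter> space M) \<omega> \<partial>M)"
      by (intro Bochner_Integration.integral_cong) (auto simp: indicator_def)
    also have "ennreal \<dots> = emeasure (distr M (Kkc_borel B) F) A"
      using vim by (simp add: emeasure_distr emeasure_eq_measure)
    finally show "emeasure (distr N (Kkc_borel B) F) A = emeasure (distr M (Kkc_borel B) F) A" .
  qed simp
  then have "(\<integral>K. h K \<partial>distr N (Kkc_borel B) F) = (\<integral>K. h K \<partial>distr M (Kkc_borel B) F)"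
    by simp
  then have "(\<integral>\<omega>. h (F \<omega>) \<partial>N) = (\<integral>\<omega>. h (F \<omega>) \<partial>M)"
    using h by (simp add: integral_distr)
  moreover have "(\<integral>\<omega>. h (F \<omega>) \<partial>N) = (\<integral>\<omega>. (T \<omega> / e (X \<omega>)) *\<^sub>R h (F \<omega>) \<partial>M)"
    unfolding N_def using h w_bounds by (intro integral_density) (auto intro!: AE_I2)
  ultimately show ?thesis
    by simp
qed

lemma sample_mean_square:
  fixes g :: "'a set \<times> 'x \<times> real \<Rightarrow> real"
  assumes g: "g \<in> borel_measurable (obs_space B S)"
    and bound: "\<And>z. z \<in> space (obs_space B S) \<Longrightarrow> \<bar>g z\<bar> \<le> K"
    and zero: "(\<integral>\<omega>. g (F \<omega>, X \<omega>, T \<omega>) \<partial>M) = 0"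
  shows "(\<integral>\<omega>. ((\<Sum>i<n. g (Fs i \<omega>, Xs i \<omega>, Ts i \<omega>)) / real n)\<^sup>2 \<partial>M) \<le> K\<^sup>2 / real n"
proof (rule mean_square_average_orthogonal)
  let ?Y = "\<lambda>i \<omega>. g (Fs i \<omega>, Xs i \<omega>, Ts i \<omega>)"
  show meas: "?Y i \<in> borel_measurable M" for i
    by (rule measurable_compose[OF sample_measurable g])
  show le: "\<bar>?Y i \<omega>\<bar> \<le> K" if "\<omega> \<in> space M" for i \<omega>
    by (intro bound measurable_space[OF sample_measurable that])
  have int: "integrable M (?Y i)" for i
    using meas le by (intro integrable_const_bound[of _ K]) (auto intro!: AE_I2)
  fix i j :: nat assume "i \<noteq> j"
  have "indep_vars (\<lambda>_. borel) ?Y {i, j}"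
    using indep_vars_subset[OF indep subset_UNIV, of "{i, j}"] g by (intro indep_vars_compose2[where Y = "\<lambda>_. g"])
  then have "(\<integral>\<omega>. (\<Prod>k\<in>{i, j}. ?Y k \<omega>) \<partial>M) = (\<Prod>k\<in>{i, j}. \<integral>\<omega>. ?Y k \<omega> \<partial>M)"
    using int by (intro indep_vars_lebesgue_integral) auto
  then show "(\<integral>\<omega>. ?Y i \<omega> * ?Y j \<omega> \<partial>M) = 0"
    using \<open>i \<noteq> j\<close> sample_expectation[OF g] zero by simp
qed

end

lemma outer_measure_of_Un_le:
  assumes "A \<subseteq> space M" "A' \<subseteq> space M"
  shows "outer_measure_of M (A \<union> A') \<le> outer_measure_of M A + outer_measure_of M A'"
proof -
  obtain E where E: "E \<in> sets M" "A \<subseteq> E" "outer_measure_of M A = emeasure M E"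
    using outer_measure_of_attain[OF assms(1)] by blast
  obtain E' where E': "E' \<in> sets M" "A' \<subseteq> E'" "outer_measure_of M A' = emeasure M E'"
    using outer_measure_of_attain[OF assms(2)] by blast
  have "outer_measure_of M (A \<union> A') \<le> outer_measure_of M (E \<union> E')"
    using E E' by (intro outer_measure_of_mono) auto
  also have "\<dots> \<le> emeasure M E + emeasure M E'"
    using E E' by (simp add: emeasure_subadditive)
  finally show ?thesis
    by (simp add: E E')
qed

lemma bigO_prob_mono_rate:
  assumes Y: "bigO_prob M Y r" and "0 \<le> c"
    and le: "\<forall>\<^sub>F n in sequentially. r n \<le> c * r' n" and nonneg: "\<And>n. 0 \<le> r' n"
  shows "bigO_prob M Y r'"
  unfolding bigO_prob_def
proof (intro allI impI)
  fix \<epsilon> :: real assume "0 < \<epsilon>"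
  then obtain C where C: "0 < C"
    "\<forall>\<^sub>F n in sequentially. outer_measure_of M {\<omega> \<in> space M. Y n \<omega> > ennreal (C * r n)} \<le> ennreal \<epsilon>"
    using Y unfolding bigO_prob_def by blast
  have "\<forall>\<^sub>F n in sequentially.
      outer_measure_of M {\<omega> \<in> space M. Y n \<omega> > ennreal (C * (c + 1) * r' n)} \<le> ennreal \<epsilon>"
    using C(2) le
  proof eventually_elim
    case (elim n)
    have "C * r n \<le> C * (c * r' n)"
      using C(1) elim(2) by simp
    also have "\<dots> \<le> C * (c + 1) * r' n"
      using C(1) nonneg[of n] by (simp add: algebra_simps)
    finally have "outer_measure_of M {\<omega> \<in> space M. Y n \<omega> > ennreal (C * (c + 1) * r' n)}
        \<le> outer_measure_of M {\<omega> \<in> space M. Y n \<omega> > ennreal (C * r n)}"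
      by (intro outer_measure_of_mono) (auto intro: le_less_trans ennreal_leI)
    with elim(1) show ?case
      by (rule order_trans[rotated])
  qed
  moreover have "0 < C * (c + 1)"
    using C(1) \<open>0 \<le> c\<close> by simp
  ultimately show "\<exists>C>0. \<forall>\<^sub>F n in sequentially.
      outer_measure_of M {\<omega> \<in> space M. Y n \<omega> > ennreal (C * r' n)} \<le> ennreal \<epsilon>"
    by blast
qed

section \<open>The rate of convergence\<close>

context ipw_sample
begin

definition true_weight :: "nat \<Rightarrow> 'w \<Rightarrow> real" where
  "true_weight i \<omega> = Ts i \<omega> / e (Xs i \<omega>)"

text \<open>A squared norm in \<open>L\<^sup>2\<close> of the sphere: its expectation is computed by exchanging the integrals,
  without any estimate that is uniform in the direction.\<close>

definition fluctuation :: "'a set \<Rightarrow> nat \<Rightarrow> 'w \<Rightarrow> real" where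
  "fluctuation G n \<omega> = (\<integral>p. ((\<Sum>i<n. true_weight i \<omega> * (support_fun p (Fs i \<omega>) - support_fun p G)) / real n)\<^sup>2
     \<partial>sphere_measure)"

lemma true_weight_measurable [measurable]: "true_weight i \<in> borel_measurable M"
proof -
  have "(\<lambda>(K, x, t). t / e x * 1) \<in> borel_measurable (obs_space B S)"
    by (rule weighted_measurable) simp
  from measurable_compose[OF sample_measurable this] show ?thesis
    by (simp add: true_weight_def[abs_def])
qed

lemma true_weight_mean_square:
  "(\<integral>\<omega>. ((\<Sum>i<n. true_weight i \<omega> - 1) / real n)\<^sup>2 \<partial>M) \<le> (1 / \<eta> + 1)\<^sup>2 / real n"
proof -
  have meas: "(\<lambda>(K, x, t). t / e x * 1) \<in> borel_measurable (obs_space B S)"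
    by (rule weighted_measurable) simp
  define g :: "'a set \<times> 'x \<times> real \<Rightarrow> real" where "g z = (case z of (K, x, t) \<Rightarrow> t / e x * 1) - 1" for z
  have "(\<integral>\<omega>. ((\<Sum>i<n. g (Fs i \<omega>, Xs i \<omega>, Ts i \<omega>)) / real n)\<^sup>2 \<partial>M) \<le> (1 / \<eta> + 1)\<^sup>2 / real n"
  proof (rule sample_mean_square)
    show "g \<in> borel_measurable (obs_space B S)"
      unfolding g_def using meas by measurable
    show "\<bar>g z\<bar> \<le> 1 / \<eta> + 1" if "z \<in> space (obs_space B S)" for z
    proof -
      obtain K x t where "z = (K, x, t)" "x \<in> S" "t \<in> {0, 1}"
        using \<open>z \<in> _\<close> by (auto simp: space_obs_space)
      then show ?thesis
        using weight_bounds[of x t] by (simp add: g_def abs_le_iff)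
    qed
    have w_meas: "(\<lambda>\<omega>. T \<omega> / e (X \<omega>)) \<in> borel_measurable M"
      using measurable_compose[OF FXT meas] by simp
    have w_bound: "norm (T \<omega> / e (X \<omega>)) \<le> 1 / \<eta>" if "\<omega> \<in> space M" for \<omega>
      using weight_bounds[of "X \<omega>" "T \<omega>"] observation_in[OF that]
      by (simp only: real_norm_def abs_of_nonneg)
    have "integrable M (\<lambda>\<omega>. T \<omega> / e (X \<omega>))"
      using w_meas w_bound by (intro integrable_const_bound[of _ "1 / \<eta>"] AE_I2)
    then have "(\<integral>\<omega>. g (F \<omega>, X \<omega>, T \<omega>) \<partial>M) = (\<integral>\<omega>. T \<omega> / e (X \<omega>) \<partial>M) - 1"
      by (simp add: g_def prob_space)
    also have "(\<integral>\<omega>. T \<omega> / e (X \<omega>) \<partial>M) = 1"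
      using weighted_expectation[of "\<lambda>_. 1"] by (simp add: prob_space)
    finally show "(\<integral>\<omega>. g (F \<omega>, X \<omega>, T \<omega>) \<partial>M) = 0"
      by simp
  qed
  then show ?thesis
    by (simp add: g_def true_weight_def)
qed

text \<open>At each direction the average has mean zero and independent bounded terms; integrating its mean
  square over the sphere keeps the rate \<open>1 / n\<close>.\<close>

lemma fluctuation_mean:
  assumes G: "G \<in> Kkc_bdd B"
    and mean: "\<And>p. norm p = 1 \<Longrightarrow> support_fun p G = (\<integral>\<omega>. support_fun p (F \<omega>) \<partial>M)"
  shows "integrable M (fluctuation G n)"
    and "(\<integral>\<omega>. fluctuation G n \<omega> \<partial>M) \<le> measure sphere_measure (sphere 0 1 :: 'a set) * (1 / \<eta> * (2 * B))\<^sup>2 / real n"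
proof -
  let ?K = "1 / \<eta> * (2 * B)"
  let ?Y = "\<lambda>p i \<omega>. true_weight i \<omega> * (support_fun p (Fs i \<omega>) - support_fun p G)"
  have term_bound: "\<bar>t / e x * (support_fun p K - support_fun p G)\<bar> \<le> ?K"
    if "K \<in> Kkc_bdd B" "x \<in> S" "t \<in> {0, 1}" "p \<in> sphere 0 1" for K x t p
  proof -
    have "\<bar>support_fun p K - support_fun p G\<bar> \<le> 2 * B"
      using support_fun_abs_le_sphere[OF that(1,4)] support_fun_abs_le_sphere[OF G that(4)] by linarith
    moreover have "\<bar>t / e x\<bar> \<le> 1 / \<eta>"
      using weight_bounds[OF that(2,3)] by (simp only: abs_of_nonneg)
    ultimately show ?thesis
      unfolding abs_mult by (intro mult_mono') auto
  qed
  have pair: "(\<lambda>(p, \<omega>). ((\<Sum>i<n. ?Y p i \<omega>) / real n)\<^sup>2) \<in> borel_measurable (sphere_measure \<Otimes>\<^sub>M M)"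
    using support_fun_random_set_measurable_pair[OF B sample_set_measurable]
      support_fun_measurable_sphere[OF G] by measurable
  have bound: "\<bar>((\<Sum>i<n. ?Y p i \<omega>) / real n)\<^sup>2\<bar> \<le> ?K\<^sup>2" if p: "p \<in> sphere 0 1" and "\<omega> \<in> space M" for p \<omega>
  proof -
    have "\<bar>\<Sum>i<n. ?Y p i \<omega>\<bar> \<le> (\<Sum>i<n. ?K)"
      using term_bound[OF _ _ _ p] sample_in[OF \<open>\<omega> \<in> space M\<close>]
      by (intro order_trans[OF sum_abs] sum_mono) (simp add: true_weight_def)
    moreover have "0 \<le> ?K"
      using B \<eta> by simp
    ultimately have "\<bar>(\<Sum>i<n. ?Y p i \<omega>) / real n\<bar> \<le> ?K"
      by (cases "n = 0") (simp_all add: divide_le_eq mult.commute)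
    then have "\<bar>(\<Sum>i<n. ?Y p i \<omega>) / real n\<bar> \<le> \<bar>?K\<bar>"
      by (rule order_trans[OF _ abs_ge_self])
    then show ?thesis
      by (simp only: abs_power2 abs_le_square_iff)
  qed
  have pointwise: "(\<integral>\<omega>. ((\<Sum>i<n. ?Y p i \<omega>) / real n)\<^sup>2 \<partial>M) \<le> ?K\<^sup>2 / real n" if p: "p \<in> sphere 0 1" for p
  proof -
    define g where "g = (\<lambda>(K, x, t). t / e x * (support_fun p K - support_fun p G))"
    have h: "(\<lambda>K. support_fun p K - support_fun p G) \<in> borel_measurable (Kkc_borel B)"
      using support_fun_measurable_Kkc_borel[OF B, of p] p by simp
    have "(\<integral>\<omega>. ((\<Sum>i<n. g (Fs i \<omega>, Xs i \<omega>, Ts i \<omega>)) / real n)\<^sup>2 \<partial>M) \<le> ?K\<^sup>2 / real n"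
    proof (rule sample_mean_square)
      show "g \<in> borel_measurable (obs_space B S)"
        unfolding g_def by (rule weighted_measurable[OF h])
      show "\<bar>g z\<bar> \<le> ?K" if "z \<in> space (obs_space B S)" for z
      proof -
        obtain K x t where "z = (K, x, t)" "K \<in> Kkc_bdd B" "x \<in> S" "t \<in> {0, 1}"
          using \<open>z \<in> _\<close> unfolding space_obs_space by (metis mem_Sigma_iff prod.exhaust)
        then show ?thesis
          using term_bound[of K x t p] p by (simp only: g_def prod.case)
      qed
      have int: "integrable M (\<lambda>\<omega>. support_fun p (F \<omega>))"
        using support_fun_random_set_measurable[OF B random_set_measurable] observation_in(1) p
        by (intro integrable_const_bound[of _ B]) (auto intro!: AE_I2 support_fun_abs_le_sphere)
      have "(\<integral>\<omega>. g (F \<omega>, X \<omega>, T \<omega>) \<partial>M) = (\<integral>\<omega>. support_fun p (F \<omega>) - support_fun p G \<partial>M)"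
        unfolding g_def using weighted_expectation[OF h] by simp
      also have "\<dots> = 0"
        using int mean[of p] p by (simp add: prob_space)
      finally show "(\<integral>\<omega>. g (F \<omega>, X \<omega>, T \<omega>) \<partial>M) = 0" .
    qed
    then show ?thesis
      by (simp add: g_def true_weight_def)
  qed
  note Fub = sphere_Fubini[OF finite_measure_axioms pair bound]
  show "integrable M (fluctuation G n)"
    unfolding fluctuation_def[abs_def] by (rule Fub(2))
  have "(\<integral>\<omega>. fluctuation G n \<omega> \<partial>M) = (\<integral>p. \<integral>\<omega>. ((\<Sum>i<n. ?Y p i \<omega>) / real n)\<^sup>2 \<partial>M \<partial>sphere_measure)"
    unfolding fluctuation_def by (rule Fub(1))
  also have "\<dots> \<le> (\<integral>p. ?K\<^sup>2 / real n \<partial>(sphere_measure :: 'a measure))"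
    using pointwise by (intro integral_mono Fub(3)) auto
  also have "\<dots> = measure sphere_measure (sphere 0 1 :: 'a set) * ?K\<^sup>2 / real n"
    by simp
  finally show "(\<integral>\<omega>. fluctuation G n \<omega> \<partial>M) \<le> measure sphere_measure (sphere 0 1 :: 'a set) * ?K\<^sup>2 / real n" .
qed

lemma fluctuation_nonneg: "0 \<le> fluctuation G n \<omega>"
  by (simp add: fluctuation_def)

lemma ipw_frechet_mean_eq:
  assumes \<omega>: "\<omega> \<in> space M" and nonneg: "\<And>x. x \<in> S \<Longrightarrow> 0 \<le> ehat n \<omega> x"
    and pos: "0 < (\<Sum>i<n. ipw_weight ehat Xs Ts n \<omega> i)"
  shows "ipw_frechet_mean B ehat Fs Xs Ts n \<omega>
    = weighted_minkowski_mean n (ipw_weight ehat Xs Ts n \<omega>) (\<lambda>i. Fs i \<omega>)"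
proof -
  have "0 \<le> ipw_weight ehat Xs Ts n \<omega> i" for i
    using nonneg[OF sample_in(2)[OF \<omega>], of i] sample_in(3)[OF \<omega>, of i] by (auto simp: ipw_weight_def)
  then show ?thesis
    unfolding ipw_frechet_mean_def using sample_in(1)[OF \<omega>] pos
    by (intro weighted_frechet_mean_eq_minkowski_mean[OF B]) auto
qed

lemma ipw_error_bound:
  assumes \<omega>: "\<omega> \<in> space M" and n: "0 < n" and G: "G \<in> Kkc_bdd B"
    and nonneg: "\<And>x. x \<in> S \<Longrightarrow> 0 \<le> ehat n \<omega> x"
    and close: "\<And>x. x \<in> S \<Longrightarrow> \<bar>ehat n \<omega> x - e x\<bar> \<le> r" and r: "0 \<le> r" "r \<le> \<eta> / 2" "r \<le> \<eta>\<^sup>2 / 8"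
    and avg: "((\<Sum>i<n. true_weight i \<omega> - 1) / real n)\<^sup>2 < (1 / 2)\<^sup>2"
  shows "d_kc (ipw_frechet_mean B ehat Fs Xs Ts n \<omega>) G
    \<le> 4 * (sqrt (fluctuation G n \<omega>) + 2 * r / \<eta>\<^sup>2 * (2 * B) * sqrt (measure sphere_measure (sphere 0 1 :: 'a set)))"
proof -
  let ?w = "ipw_weight ehat Xs Ts n \<omega>"
  have w_nonneg: "0 \<le> ?w i" for i
    using nonneg[OF sample_in(2)[OF \<omega>], of i] sample_in(3)[OF \<omega>, of i] by (auto simp: ipw_weight_def)
  \<comment> \<open>The denominators satisfy \<open>e \<ge> \<eta>\<close> and \<open>ehat \<ge> \<eta> / 2\<close>.\<close>
  have w_close: "\<bar>?w i - true_weight i \<omega>\<bar> \<le> 2 * r / \<eta>\<^sup>2" for i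
  proof -
    let ?x = "Xs i \<omega>"
    have x: "?x \<in> S"
      using sample_in(2)[OF \<omega>] .
    have e_ge: "\<eta> \<le> e ?x" and ehat_ge: "\<eta> / 2 \<le> ehat n \<omega> ?x"
      using overlap[OF x] close[OF x] r by (auto simp: abs_le_iff)
    then have pos: "0 < e ?x" "0 < ehat n \<omega> ?x"
      using \<eta> by auto
    have "?w i - true_weight i \<omega> = Ts i \<omega> * ((e ?x - ehat n \<omega> ?x) / (ehat n \<omega> ?x * e ?x))"
      using pos by (simp add: ipw_weight_def true_weight_def field_simps)
    then have "\<bar>?w i - true_weight i \<omega>\<bar> \<le> \<bar>ehat n \<omega> ?x - e ?x\<bar> / (ehat n \<omega> ?x * e ?x)"
      using sample_in(3)[OF \<omega>, of i] pos by (auto simp: abs_mult abs_minus_commute)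
    also have "\<dots> \<le> r / (\<eta> / 2 * \<eta>)"
      using close[OF x] e_ge ehat_ge \<eta> r by (intro frac_le mult_mono) auto
    finally show ?thesis
      by (simp add: power2_eq_square mult.commute)
  qed
  have "\<bar>(\<Sum>i<n. true_weight i \<omega> - 1) / real n\<bar> < 1 / 2"
    using avg abs_le_square_iff[of "1 / 2" "(\<Sum>i<n. true_weight i \<omega> - 1) / real n"] by linarith
  moreover have "(\<Sum>i<n. true_weight i \<omega> - 1) / real n = (\<Sum>i<n. true_weight i \<omega>) / real n - 1"
    using n by (simp add: sum_subtractf diff_divide_distrib)
  ultimately have avg': "1 / 2 \<le> (\<Sum>i<n. true_weight i \<omega>) / real n"
    by linarith
  have \<kappa>: "0 \<le> 2 * r / \<eta>\<^sup>2" "2 * r / \<eta>\<^sup>2 \<le> 1 / 4"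
    using r \<eta> by (auto simp: divide_le_eq)
  note pert = weighted_minkowski_mean_perturbation[of B n "\<lambda>i. Fs i \<omega>" G ?w "\<lambda>i. true_weight i \<omega>",
      OF B sample_in(1)[OF \<omega>] G w_nonneg w_close \<kappa> n avg']
  have "ipw_frechet_mean B ehat Fs Xs Ts n \<omega> = weighted_minkowski_mean n ?w (\<lambda>i. Fs i \<omega>)"
    using nonneg by (intro ipw_frechet_mean_eq \<omega> pert(1))
  with pert(2) show ?thesis
    by (simp only: fluctuation_def)
qed

text \<open>Each of three exceptional events receives a third of the allowed probability: the propensity
  estimator being far off, the average true weight being far from \<open>1\<close> (Chebyshev), and a large fluctuation (Markov).\<close>

lemma ipw_frechet_mean_rate:
  assumes nonneg: "\<And>n \<omega> x. \<omega> \<in> space M \<Longrightarrow> x \<in> S \<Longrightarrow> 0 \<le> ehat n \<omega> x"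
    and \<rho>_nonneg: "\<And>n. 0 \<le> \<rho> n" and \<rho>: "\<rho> \<longlonglongrightarrow> 0"
    and rate: "bigO_prob M (\<lambda>n \<omega>. sup_dist S (ehat n \<omega>) e) \<rho>"
  shows "bigO_prob M
    (\<lambda>n \<omega>. ennreal (d_kc (ipw_frechet_mean B ehat Fs Xs Ts n \<omega>) (frechet_mean M B F)))
    (\<lambda>n. 1 / sqrt (real n) + \<rho> n)"
  unfolding bigO_prob_def
proof (intro allI impI)
  fix \<epsilon> :: real assume "0 < \<epsilon>"
  obtain G where G: "G \<in> Kkc_bdd B" and G_mean: "\<And>p. support_fun p G = (\<integral>\<omega>. support_fun p (F \<omega>) \<partial>M)"
    using expected_support_fun[OF prob_space_axioms B random_set_measurable] by metis
  have frechet: "frechet_mean M B F = G"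
    using G_mean by (intro frechet_mean_eq_expectation[OF prob_space_axioms B random_set_measurable G]) auto
  \<comment> \<open>The mean fluctuation is at most \<open>c / n\<close>; by Markov it exceeds \<open>L / n\<close> with probability at most
    \<open>c / L \<le> \<epsilon> / 3\<close>.  The summand \<open>1\<close> keeps \<open>L\<close> positive.\<close>
  define c where "c = measure sphere_measure (sphere 0 1 :: 'a set) * (1 / \<eta> * (2 * B))\<^sup>2"
  define L where "L = c / (\<epsilon> / 3) + 1"
  have "0 \<le> c"
    by (simp add: c_def)
  then have L: "0 < L" "c \<le> L * (\<epsilon> / 3)"
    using \<open>0 < \<epsilon>\<close> by (auto simp: L_def field_simps intro!: add_nonneg_pos)
  obtain C\<^sub>0 where C\<^sub>0: "0 < C\<^sub>0" "\<forall>\<^sub>F n in sequentially.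
      outer_measure_of M {\<omega> \<in> space M. sup_dist S (ehat n \<omega>) e > ennreal (C\<^sub>0 * \<rho> n)} \<le> ennreal (\<epsilon> / 3)"
    using rate \<open>0 < \<epsilon>\<close> unfolding bigO_prob_def by (meson divide_pos_pos zero_less_numeral)
  define C where "C = 4 * (sqrt L + 2 * C\<^sub>0 / \<eta>\<^sup>2 * (2 * B) * sqrt (measure sphere_measure (sphere 0 1 :: 'a set)))"
  have "0 < C"
    using L(1) C\<^sub>0(1) B by (auto simp: C_def intro!: add_pos_nonneg)
  have C_ge: "4 * sqrt L \<le> C" "4 * (2 * C\<^sub>0 / \<eta>\<^sup>2 * (2 * B) * sqrt (measure sphere_measure (sphere 0 1 :: 'a set))) \<le> C"
    using L(1) C\<^sub>0(1) B by (auto simp: C_def)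
  have "(\<lambda>n. C\<^sub>0 * \<rho> n) \<longlonglongrightarrow> C\<^sub>0 * 0"
    by (intro tendsto_intros \<rho>)
  \<comment> \<open>The two thresholds give \<open>ehat \<ge> \<eta> / 2\<close> and a weight error of at most \<open>1 / 4\<close>.\<close>
  then have small: "\<forall>\<^sub>F n in sequentially. C\<^sub>0 * \<rho> n < min (\<eta> / 2) (\<eta>\<^sup>2 / 8)"
    using \<eta> by (intro order_tendstoD(2)) auto
  have "(\<lambda>n. 4 * (1 / \<eta> + 1)\<^sup>2 / real n) \<longlonglongrightarrow> 0"
    by (rule lim_const_over_n)
  then have cheb: "\<forall>\<^sub>F n in sequentially. 4 * (1 / \<eta> + 1)\<^sup>2 / real n < \<epsilon> / 3"
    using \<open>0 < \<epsilon>\<close> by (intro order_tendstoD(2)) auto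
  have "\<forall>\<^sub>F n in sequentially. outer_measure_of M
      {\<omega> \<in> space M. ennreal (C * (1 / sqrt (real n) + \<rho> n))
        < ennreal (d_kc (ipw_frechet_mean B ehat Fs Xs Ts n \<omega>) G)} \<le> ennreal \<epsilon>"
    using C\<^sub>0(2) small cheb eventually_gt_at_top[of 0]
  proof eventually_elim
    case (elim n)
    define E\<^sub>1 where "E\<^sub>1 = {\<omega> \<in> space M. sup_dist S (ehat n \<omega>) e > ennreal (C\<^sub>0 * \<rho> n)}"
    define E\<^sub>2 where "E\<^sub>2 = {\<omega> \<in> space M. (1 / 2)\<^sup>2 \<le> ((\<Sum>i<n. true_weight i \<omega> - 1) / real n)\<^sup>2}"
    define E\<^sub>3 where "E\<^sub>3 = {\<omega> \<in> space M. L / real n \<le> fluctuation G n \<omega>}"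
    note fl = fluctuation_mean[OF G G_mean, of n]
    have "integrable M (\<lambda>\<omega>. ((\<Sum>i<n. true_weight i \<omega> - 1) / real n)\<^sup>2)"
    proof (rule integrable_const_bound[of _ "(1 / \<eta> + 1)\<^sup>2"], rule AE_I2)
      fix \<omega> assume \<omega>: "\<omega> \<in> space M"
      have "\<bar>\<Sum>i<n. true_weight i \<omega> - 1\<bar> \<le> (\<Sum>i<n. 1 / \<eta> + 1)"
      proof (intro order_trans[OF sum_abs] sum_mono)
        fix i
        show "\<bar>true_weight i \<omega> - 1\<bar> \<le> 1 / \<eta> + 1"
          using weight_bounds[OF sample_in(2,3)[OF \<omega>], of i i] by (simp add: true_weight_def abs_le_iff)
      qed
      then have "\<bar>(\<Sum>i<n. true_weight i \<omega> - 1) / real n\<bar> \<le> \<bar>1 / \<eta> + 1\<bar>"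
        using elim(4) \<eta> by (simp add: divide_le_eq mult.commute)
      then show "norm (((\<Sum>i<n. true_weight i \<omega> - 1) / real n)\<^sup>2) \<le> (1 / \<eta> + 1)\<^sup>2"
        by (simp only: real_norm_def abs_power2 abs_le_square_iff)
    qed measurable
    then have "emeasure M E\<^sub>2
        \<le> ennreal (1 / (1 / 2)\<^sup>2 * (\<integral>\<omega>. ((\<Sum>i<n. true_weight i \<omega> - 1) / real n)\<^sup>2 \<partial>M))"
      unfolding E\<^sub>2_def by (intro integral_Markov_inequality) auto
    also have "\<dots> \<le> ennreal (\<epsilon> / 3)"
      using true_weight_mean_square[of n] elim(3) by (intro ennreal_leI) (simp add: power2_eq_square)
    finally have E\<^sub>2: "emeasure M E\<^sub>2 \<le> ennreal (\<epsilon> / 3)" .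
    have "emeasure M E\<^sub>3 \<le> ennreal (1 / (L / real n) * (\<integral>\<omega>. fluctuation G n \<omega> \<partial>M))"
      unfolding E\<^sub>3_def using fl(1) fluctuation_nonneg L(1) elim(4)
      by (intro integral_Markov_inequality) auto
    also have "\<dots> \<le> ennreal (\<epsilon> / 3)"
    proof (rule ennreal_leI)
      have "1 / (L / real n) * (\<integral>\<omega>. fluctuation G n \<omega> \<partial>M) \<le> 1 / (L / real n) * (c / real n)"
        using fl(2) L(1) by (intro mult_left_mono) (auto simp: c_def)
      also have "\<dots> = c / L"
        using elim(4) by simp
      also have "\<dots> \<le> \<epsilon> / 3"
        using L by (simp add: divide_le_eq mult.commute)
      finally show "1 / (L / real n) * (\<integral>\<omega>. fluctuation G n \<omega> \<partial>M) \<le> \<epsilon> / 3" .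
    qed
    finally have E\<^sub>3: "emeasure M E\<^sub>3 \<le> ennreal (\<epsilon> / 3)" .
    have E\<^sub>2_sets: "E\<^sub>2 \<in> sets M" and E\<^sub>3_sets: "E\<^sub>3 \<in> sets M"
      unfolding E\<^sub>2_def E\<^sub>3_def using borel_measurable_integrable[OF fl(1)] by measurable
    have "{\<omega> \<in> space M. ennreal (C * (1 / sqrt (real n) + \<rho> n))
        < ennreal (d_kc (ipw_frechet_mean B ehat Fs Xs Ts n \<omega>) G)} \<subseteq> E\<^sub>1 \<union> (E\<^sub>2 \<union> E\<^sub>3)"
    proof (rule subsetI, rule ccontr)
      fix \<omega> assume large: "\<omega> \<in> {\<omega> \<in> space M. ennreal (C * (1 / sqrt (real n) + \<rho> n))
          < ennreal (d_kc (ipw_frechet_mean B ehat Fs Xs Ts n \<omega>) G)}"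
        and "\<omega> \<notin> E\<^sub>1 \<union> (E\<^sub>2 \<union> E\<^sub>3)"
      then have \<omega>: "\<omega> \<in> space M" and good: "sup_dist S (ehat n \<omega>) e \<le> ennreal (C\<^sub>0 * \<rho> n)"
        "((\<Sum>i<n. true_weight i \<omega> - 1) / real n)\<^sup>2 < (1 / 2)\<^sup>2" "fluctuation G n \<omega> \<le> L / real n"
        by (auto simp: E\<^sub>1_def E\<^sub>2_def E\<^sub>3_def not_le not_less)
      have r: "0 \<le> C\<^sub>0 * \<rho> n"
        using C\<^sub>0(1) \<rho>_nonneg by simp
      have close: "\<bar>ehat n \<omega> x - e x\<bar> \<le> C\<^sub>0 * \<rho> n" if "x \<in> S" for x
      proof -
        have "ennreal \<bar>ehat n \<omega> x - e x\<bar> \<le> sup_dist S (ehat n \<omega>) e"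
          unfolding sup_dist_def using that by (rule SUP_upper)
        with good(1) have "ennreal \<bar>ehat n \<omega> x - e x\<bar> \<le> ennreal (C\<^sub>0 * \<rho> n)"
          by (rule order_trans[rotated])
        then show ?thesis
          using r by simp
      qed
      have "d_kc (ipw_frechet_mean B ehat Fs Xs Ts n \<omega>) G
          \<le> 4 * (sqrt (fluctuation G n \<omega>) + 2 * (C\<^sub>0 * \<rho> n) / \<eta>\<^sup>2 * (2 * B) * sqrt (measure sphere_measure (sphere 0 1 :: 'a set)))"
        using elim(2) nonneg[OF \<omega>] close r good(2) by (intro ipw_error_bound[OF \<omega> elim(4) G]) auto
      also have "\<dots> \<le> 4 * (sqrt (L / real n) + 2 * (C\<^sub>0 * \<rho> n) / \<eta>\<^sup>2 * (2 * B) * sqrt (measure sphere_measure (sphere 0 1 :: 'a set)))"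
        using good(3) by simp
      also have "\<dots> = 4 * sqrt L * (1 / sqrt (real n))
          + 4 * (2 * C\<^sub>0 / \<eta>\<^sup>2 * (2 * B) * sqrt (measure sphere_measure (sphere 0 1 :: 'a set))) * \<rho> n"
        by (simp add: real_sqrt_divide algebra_simps)
      also have "\<dots> \<le> C * (1 / sqrt (real n)) + C * \<rho> n"
        using C_ge \<rho>_nonneg by (intro add_mono mult_right_mono) auto
      finally show False
        using large by (simp add: algebra_simps ennreal_leI leD)
    qed
    then have "outer_measure_of M {\<omega> \<in> space M. ennreal (C * (1 / sqrt (real n) + \<rho> n))
        < ennreal (d_kc (ipw_frechet_mean B ehat Fs Xs Ts n \<omega>) G)} \<le> outer_measure_of M (E\<^sub>1 \<union> (E\<^sub>2 \<union> E\<^sub>3))"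
      by (rule outer_measure_of_mono)
    also have "\<dots> \<le> outer_measure_of M E\<^sub>1 + (outer_measure_of M E\<^sub>2 + outer_measure_of M E\<^sub>3)"
      by (intro order_trans[OF outer_measure_of_Un_le] add_left_mono outer_measure_of_Un_le)
         (auto simp: E\<^sub>1_def E\<^sub>2_def E\<^sub>3_def)
    also have "\<dots> \<le> ennreal (\<epsilon> / 3) + (ennreal (\<epsilon> / 3) + ennreal (\<epsilon> / 3))"
      using elim(1) E\<^sub>2 E\<^sub>3 by (intro add_mono) (simp_all add: E\<^sub>1_def E\<^sub>2_sets E\<^sub>3_sets)
    also have "\<dots> = ennreal \<epsilon>"
      using \<open>0 < \<epsilon>\<close> by (simp flip: ennreal_plus)
    finally show ?case .
  qed
  with \<open>0 < C\<close> show "\<exists>C>0. \<forall>\<^sub>F n in sequentially. outer_measure_of M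
      {\<omega> \<in> space M. ennreal (C * (1 / sqrt (real n) + \<rho> n))
        < ennreal (d_kc (ipw_frechet_mean B ehat Fs Xs Ts n \<omega>) (frechet_mean M B F))} \<le> ennreal \<epsilon>"
    unfolding frechet by blast
qed

end

theorem proposition3p3:
  fixes M :: "'w measure"
    and B \<eta>\<^sub>0 \<delta>' varpi1 :: real
    and S :: "(real ^ 'p) set"
    and F :: "'w \<Rightarrow> (real ^ 'd) set" and X :: "'w \<Rightarrow> real ^ 'p" and T :: "'w \<Rightarrow> real"
    and Fs :: "nat \<Rightarrow> 'w \<Rightarrow> (real ^ 'd) set" and Xs :: "nat \<Rightarrow> 'w \<Rightarrow> real ^ 'p"
    and Ts :: "nat \<Rightarrow> 'w \<Rightarrow> real"
    and e :: "real ^ 'p \<Rightarrow> real" and ehat :: "nat \<Rightarrow> 'w \<Rightarrow> real ^ 'p \<Rightarrow> real"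
    and \<E> :: "(real ^ 'p \<Rightarrow> real) set"
    and \<rho> :: "nat \<Rightarrow> real"
  assumes prob: "prob_space M"
    and B: "0 < B"
    and S: "compact S"
    and FXT: "(\<lambda>\<omega>. (F \<omega>, X \<omega>, T \<omega>)) \<in> measurable M (obs_space B S)"
    and mar: "cond_indep_given M (sigma_gen_by M X) (Kkc_borel B) F (count_space {0, 1}) T"
    and indep: "prob_space.indep_vars M (\<lambda>_. obs_space B S)
                  (\<lambda>i \<omega>. (Fs i \<omega>, Xs i \<omega>, Ts i \<omega>)) UNIV"
    and ident: "\<And>i. distr M (obs_space B S) (\<lambda>\<omega>. (Fs i \<omega>, Xs i \<omega>, Ts i \<omega>)) =
                     distr M (obs_space B S) (\<lambda>\<omega>. (F \<omega>, X \<omega>, T \<omega>))"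
    and e: "is_propensity M S X T e"
    and ehat_rv: "\<And>n x. x \<in> S \<Longrightarrow> (\<lambda>\<omega>. ehat n \<omega> x) \<in> borel_measurable M"
    and ehat_nonneg: "\<And>n \<omega> x. \<omega> \<in> space M \<Longrightarrow> x \<in> S \<Longrightarrow> 0 \<le> ehat n \<omega> x"
    and e_class: "e \<in> \<E>"
    and ehat_class: "\<And>n \<omega>. \<omega> \<in> space M \<Longrightarrow> ehat n \<omega> \<in> \<E>"
    and eta: "0 < \<eta>\<^sub>0" "\<eta>\<^sub>0 < 1 / 2"
    and overlap: "\<And>x. x \<in> S \<Longrightarrow> \<eta>\<^sub>0 \<le> e x \<and> e x \<le> 1 - \<eta>\<^sub>0"
    and rho_nonneg: "\<And>n. 0 \<le> \<rho> n"
    and rho: "\<rho> \<longlonglongrightarrow> 0"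
    and ehat_rate: "bigO_prob M (\<lambda>n \<omega>. sup_dist S (ehat n \<omega>) e) \<rho>"
    and delta': "0 < \<delta>'"
    and w1: "0 < varpi1" "varpi1 < 1"
    and entropy: "\<exists>C. \<forall>\<^sub>F \<delta> in at_right 0.
                    entropy_integral S \<E> e \<delta>' \<delta> \<le> ennreal (C * \<delta> powr (- varpi1))"
    and dim: "CARD('d) \<le> 4"
  shows "(\<forall>n. \<forall>\<omega>\<in>space M. (\<Sum>i<n. ipw_weight ehat Xs Ts n \<omega> i) > 0 \<longrightarrow>
            ipw_frechet_mean B ehat Fs Xs Ts n \<omega> =
              weighted_minkowski_mean n (ipw_weight ehat Xs Ts n \<omega>) (\<lambda>i. Fs i \<omega>)) \<and>
         (\<forall>varpi2. 0 < varpi2 \<and> varpi2 < 1 \<longrightarrow>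
            bigO_prob M
              (\<lambda>n \<omega>. ennreal (d_kc (ipw_frechet_mean B ehat Fs Xs Ts n \<omega>) (frechet_mean M B F)))
              (\<lambda>n. real n powr (- (1 / (2 * (1 + max ((real CARD('d) - 1) / 4) varpi1))))
                    + \<rho> n powr varpi2))"
proof -
  interpret ipw_sample M B \<eta>\<^sub>0 S F X T Fs Xs Ts e
    using overlap by (intro ipw_sample.intro prob ipw_sample_axioms.intro B eta FXT mar indep ident e) auto
  show ?thesis
  proof (intro conjI allI impI ballI)
    fix n \<omega> assume "\<omega> \<in> space M" "0 < (\<Sum>i<n. ipw_weight ehat Xs Ts n \<omega> i)"
    then show "ipw_frechet_mean B ehat Fs Xs Ts n \<omega>
        = weighted_minkowski_mean n (ipw_weight ehat Xs Ts n \<omega>) (\<lambda>i. Fs i \<omega>)"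
      using ehat_nonneg by (intro ipw_frechet_mean_eq) auto
  next
    fix varpi2 :: real assume varpi2: "0 < varpi2 \<and> varpi2 < 1"
    define m where "m = max ((real CARD('d) - 1) / 4) varpi1"
    let ?r = "\<lambda>n. real n powr (- (1 / (2 * (1 + m)))) + \<rho> n powr varpi2"
    have "0 \<le> m"
      using w1 by (simp add: m_def)
    have "\<forall>\<^sub>F n in sequentially. \<rho> n < 1"
      using rho by (rule order_tendstoD(2)) simp
    then have "\<forall>\<^sub>F n in sequentially. 1 / sqrt (real n) + \<rho> n \<le> 1 * ?r n"
      using eventually_gt_at_top[of 0]
    proof eventually_elim
      case (elim n)
      have "1 / sqrt (real n) = real n powr (- (1 / 2))"
        using elim(2) powr_minus[of "real n" "1 / 2"] by (simp only: powr_half_sqrt inverse_eq_divide of_nat_0_le_iff)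
      also have "\<dots> \<le> real n powr (- (1 / (2 * (1 + m))))"
        using elim(2) \<open>0 \<le> m\<close> by (intro powr_mono le_imp_neg_le frac_le) auto
      finally have "1 / sqrt (real n) \<le> real n powr (- (1 / (2 * (1 + m))))" .
      moreover have "\<rho> n \<le> \<rho> n powr varpi2"
        using powr_mono'[of varpi2 1 "\<rho> n"] rho_nonneg[of n] elim(1) varpi2 by simp
      ultimately show ?case
        by simp
    qed
    then show "bigO_prob M
        (\<lambda>n \<omega>. ennreal (d_kc (ipw_frechet_mean B ehat Fs Xs Ts n \<omega>) (frechet_mean M B F)))
        (\<lambda>n. real n powr (- (1 / (2 * (1 + max ((real CARD('d) - 1) / 4) varpi1)))) + \<rho> n powr varpi2)"
      unfolding m_def[symmetric]
      using bigO_prob_mono_rate[OF ipw_frechet_mean_rate[OF ehat_nonneg rho_nonneg rho ehat_rate], of 1 ?r]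
      by auto
  qed
qed

end
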